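(* Let $M=(M_n)_{n\in\mathbb Z}$ be a stationary ergodic Markov chain on a countable state space with exponential return times. Then $M$ is a finitary factor of an i.i.d.\ process, with a coding window which has exponential tails.
   Context: A process $X=(X_n)_{n\in\mathbb Z}$ is a factor of a process $Y=(Y_n)_{n\in\mathbb Z}$ if there is a measurable function $\varphi$ such that $X_n=\varphi(\dots,Y_{n-1},Y_n,Y_{n+1},\dots)$ for all $n$, where $\varphi$ applied at time $n$ means applying it to the sequence shifted so that $Y_n$ is at the origin (i.e. the factor map commutes with the shift). The factor is finitary if there is an almost surely finite stopping time $R$ with respect to the filtration $(\mathcal F_r)_{r\ge 0}$, $\mathcal F_r=\sigma(Y_n: |n|\le r)$, such that $X_0$ is $\mathcal F_R$-measurable; such an $R$ is called a coding window. The coding window has exponential tails if there are $C,c>0$ with $\mathbb P(R\ge r)\le Ce^{-cr}$ for all $r\ge1$. A Markov chain on a countable state space is called ergodic if it is irreducible, aperiodic and positive recurrent. It has exponential return times if for some (equivalently every) state $s$, the return time $T$ to $s$ of the chain started at $s$ satisfies $\mathbb P(T\ge n)\le Ce^{-cn}$ for some $C,c>0$ and all $n$. *)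

theory Defs
  imports "HOL-Probability.Probability"
begin

definition stochastic_matrix :: "('a::countable \<Rightarrow> 'a \<Rightarrow> real) \<Rightarrow> bool" where
  "stochastic_matrix P \<longleftrightarrow> (\<forall>x y. 0 \<le> P x y) \<and> (\<forall>x. ((\<lambda>y. P x y) has_sum 1) UNIV)"

fun nstep :: "('a::countable \<Rightarrow> 'a \<Rightarrow> real) \<Rightarrow> nat \<Rightarrow> 'a \<Rightarrow> 'a \<Rightarrow> real" where
  "nstep P 0 x y = (if x = y then 1 else 0)"
| "nstep P (Suc n) x y = (\<Sum>\<^sub>\<infinity>z. P x z * nstep P n z y)"

definition irreducible_chain :: "('a::countable \<Rightarrow> 'a \<Rightarrow> real) \<Rightarrow> bool" where
  "irreducible_chain P \<longleftrightarrow> (\<forall>x y. \<exists>n. nstep P n x y > 0)"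

definition aperiodic_chain :: "('a::countable \<Rightarrow> 'a \<Rightarrow> real) \<Rightarrow> bool" where
  "aperiodic_chain P \<longleftrightarrow> (\<forall>x. Gcd {n. n \<ge> 1 \<and> nstep P n x x > 0} = 1)"

fun avoid :: "('a::countable \<Rightarrow> 'a \<Rightarrow> real) \<Rightarrow> 'a \<Rightarrow> nat \<Rightarrow> 'a \<Rightarrow> real" where
  "avoid P s 0 x = 1"
| "avoid P s (Suc n) x = (\<Sum>\<^sub>\<infinity>y\<in>{y. y \<noteq> s}. P x y * avoid P s n y)"

text \<open>return_tail P s n = P_s(T \<ge> n), where T = min{k \<ge> 1. X_k = s} is the return
  time to s of the chain started at s (T \<ge> n iff X_1,...,X_{n-1} \<noteq> s).\<close>
definition return_tail :: "('a::countable \<Rightarrow> 'a \<Rightarrow> real) \<Rightarrow> 'a \<Rightarrow> nat \<Rightarrow> real" where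
  "return_tail P s n = avoid P s (n - 1) s"

text \<open>Positive recurrence: E_s[T] = sum_{n\<ge>1} P_s(T \<ge> n) < \<infinity> for every state s
  (this also forces P_s(T < \<infinity>) = 1).\<close>
definition positive_recurrent :: "('a::countable \<Rightarrow> 'a \<Rightarrow> real) \<Rightarrow> bool" where
  "positive_recurrent P \<longleftrightarrow> (\<forall>s. summable (\<lambda>n. return_tail P s (Suc n)))"

definition ergodic_chain :: "('a::countable \<Rightarrow> 'a \<Rightarrow> real) \<Rightarrow> bool" where
  "ergodic_chain P \<longleftrightarrow> irreducible_chain P \<and> aperiodic_chain P \<and> positive_recurrent P"

definition exponential_return_times :: "('a::countable \<Rightarrow> 'a \<Rightarrow> real) \<Rightarrow> bool" where
  "exponential_return_times P \<longleftrightarrow>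
     (\<exists>s. \<exists>C c. c > 0 \<and> (\<forall>n. return_tail P s n \<le> C * exp (- c * real n)))"

definition stationary_markov_chain ::
  "'w measure \<Rightarrow> (int \<Rightarrow> 'w \<Rightarrow> 'a::countable) \<Rightarrow> ('a \<Rightarrow> 'a \<Rightarrow> real) \<Rightarrow> bool" where
  "stationary_markov_chain \<Omega> M P \<longleftrightarrow>
     prob_space \<Omega> \<and> stochastic_matrix P \<and>
     (\<forall>n. M n \<in> measurable \<Omega> (count_space UNIV)) \<and>
     (\<forall>m x. measure \<Omega> {\<omega>\<in>space \<Omega>. M m \<omega> = x} = measure \<Omega> {\<omega>\<in>space \<Omega>. M 0 \<omega> = x}) \<and>
     (\<forall>m xs. xs \<noteq> [] \<longrightarrow>
        measure \<Omega> {\<omega>\<in>space \<Omega>. \<forall>i<length xs. M (m + int i) \<omega> = xs ! i}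
        = measure \<Omega> {\<omega>\<in>space \<Omega>. M m \<omega> = hd xs} * (\<Prod>i<length xs - 1. P (xs ! i) (xs ! Suc i)))"

definition iid_process :: "real measure \<Rightarrow> (int \<Rightarrow> real) measure" where
  "iid_process \<nu> = PiM UNIV (\<lambda>_. \<nu>)"

definition window_sigma :: "nat \<Rightarrow> (int \<Rightarrow> real) measure" where
  "window_sigma r = sigma UNIV {{y. y k \<in> B} | k B. \<bar>k\<bar> \<le> int r \<and> B \<in> sets borel}"

definition shift_seq :: "int \<Rightarrow> (int \<Rightarrow> real) \<Rightarrow> (int \<Rightarrow> real)" where
  "shift_seq n y = (\<lambda>k. y (k + n))"

text \<open>R is an a.s. finite stopping time for (F_r) and \<phi> (i.e. X_0) is F_R-measurable.\<close>
definition coding_window ::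
  "real measure \<Rightarrow> ((int \<Rightarrow> real) \<Rightarrow> 'a) \<Rightarrow> ((int \<Rightarrow> real) \<Rightarrow> enat) \<Rightarrow> bool" where
  "coding_window \<nu> \<phi> R \<longleftrightarrow>
     (\<forall>r::nat. {y. R y \<le> enat r} \<in> sets (window_sigma r)) \<and>
     (AE y in iid_process \<nu>. R y \<noteq> \<infinity>) \<and>
     \<phi> \<in> measurable (PiM UNIV (\<lambda>_. borel)) (count_space UNIV) \<and>
     (\<forall>A r. \<phi> -` A \<inter> {y. R y \<le> enat r} \<in> sets (window_sigma r))"

definition exponential_tails :: "real measure \<Rightarrow> ((int \<Rightarrow> real) \<Rightarrow> enat) \<Rightarrow> bool" where
  "exponential_tails \<nu> R \<longleftrightarrow>
     (\<exists>C c. C > 0 \<and> c > 0 \<and>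
        (\<forall>r::nat. r \<ge> 1 \<longrightarrow> measure (iid_process \<nu>) {y. R y \<ge> enat r} \<le> C * exp (- c * real r)))"

definition finitary_factor_of_iid_exp_tails :: "'w measure \<Rightarrow> (int \<Rightarrow> 'w \<Rightarrow> 'a::countable) \<Rightarrow> bool" where
  "finitary_factor_of_iid_exp_tails \<Omega> M \<longleftrightarrow>
     (\<exists>\<nu> \<phi> R. prob_space \<nu> \<and> sets \<nu> = sets borel \<and>
        coding_window \<nu> \<phi> R \<and> exponential_tails \<nu> R \<and>
        distr (iid_process \<nu>) (PiM UNIV (\<lambda>_. count_space UNIV)) (\<lambda>y n. \<phi> (shift_seq n y))
        = distr \<Omega> (PiM UNIV (\<lambda>_. count_space UNIV)) (\<lambda>\<omega> n. M n \<omega>))"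

end

theory Submission
  imports Defs "HOL-Complex_Analysis.Complex_Analysis"
begin

text \<open>
  Mark a site of an i.i.d. Bernoulli(\<open>p\<close>) sequence when it carries a one preceded by \<open>m\<close> zeros. The
  marks form a renewal process that is a block factor of the i.i.d. sequence, and its renewal sequence
  is constant beyond distance \<open>m\<close>. The chain, observed along its visits to \<open>s\<close>, can be stopped at a
  randomised visit to \<open>s\<close> so that the elapsed time has exactly the law of the gap between marks, provided
  the mass that must remain unstopped at each visit, a coefficient of \<open>(1 - z) U(z) A(z)\<close>, is nonnegative;
  here \<open>U\<close> generates the return probabilities and \<open>A\<close> the gap tails. Exponential return times and aperiodicity make \<open>(1 - z) U(z)\<close>
  analytic beyond the unit disc, so these coefficients are nonnegative once \<open>m\<close> is large and then \<open>p\<close>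
  is small. Hence the chain can be coupled to the marks so that it sits at \<open>s\<close> at every mark, and given
  the marks it is an inhomogeneous chain that can be sampled backwards in time from the next mark with
  independent uniform variables. The state at the origin thus only depends on the marks around it.
\<close>

section \<open>Renewal sequences with exponential tails\<close>

text \<open>The analyticity rests on \<open>(1 - z) U(z) T(z) = 1\<close>, where \<open>T\<close>
  generates the tails of the return time; the identity splits a path at its last visit to
  \<open>s\<close>. \<open>T\<close> converges beyond the unit disc and aperiodicity excludes zeros
  in the closed disc, so \<open>1 / T\<close> extends. The two parameters act at different ranges.
  Up to distance \<open>m\<close> the gap tails are 1 and the critical coefficients are return
  probabilities. Beyond \<open>m\<close> the return probabilities are near a positive limit, and for
  small \<open>p\<close> the gap tails vary too slowly for the correction to outweigh it. Sampling
  runs backwards because whether a visit to \<open>s\<close> becomes a mark depends on the age of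
  the last mark but not on the previous state. Given the age at a site and the next state, one
  kernel therefore serves whether or not the next site is marked, whereas a forward sampler would
  have to be conditioned on the distance to the next mark. To compute laws, the recursion is started
  at a fixed site with the law of the state given the age. All path probabilities are then exact,
  and a later mark erases the choice of the start.\<close>

lemma unit_circle_real_part_eq_1:
  fixes z :: complex
  assumes "norm z \<le> 1" "Re z = 1"
  shows "z = 1"
proof -
  have "(Re z)^2 + (Im z)^2 \<le> 1"
    using assms(1) by (simp add: cmod_def)
  with assms(2) show ?thesis by (simp add: complex_eq_iff)
qed

text \<open>The order of \<open>z\<close> divides every exponent \<open>n\<close> with
  \<open>z ^ n = 1\<close>, hence all of \<open>S\<close>. If \<open>z\<close> has no positive such
  exponent, \<open>S\<close> is contained in \<open>{0}\<close>, whose \<open>Gcd\<close> is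
  0.\<close>

lemma roots_of_unity_gcd:
  fixes z :: complex
  assumes "\<And>n. n \<in> S \<Longrightarrow> z ^ n = 1" "Gcd S = (1::nat)"
  shows "z = 1"
proof (cases "\<exists>n>0. z ^ n = 1")
  case True
  define d where "d = (LEAST n. n > 0 \<and> z ^ n = 1)"
  have d: "d > 0" "z ^ d = 1"
    using LeastI_ex[OF True] unfolding d_def by auto
  have "d dvd n" if "z ^ n = 1" for n
  proof (rule ccontr)
    assume "\<not> d dvd n"
    then have pos: "n mod d > 0" by (simp add: dvd_eq_mod_eq_0)
    have "z ^ n = (z ^ d) ^ (n div d) * z ^ (n mod d)"
      by (metis mult_div_mod_eq power_add power_mult)
    then have "z ^ (n mod d) = 1" using d that by simp
    then have "d \<le> n mod d" using pos Least_le[of "\<lambda>n. n > 0 \<and> z ^ n = 1" "n mod d"] by (simp add: d_def[symmetric])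
    moreover have "n mod d < d" using d(1) by simp
    ultimately show False by simp
  qed
  then have "d dvd Gcd S" using assms(1) by (intro Gcd_greatest) auto
  then have "d = 1" using assms(2) by simp
  with d show ?thesis by simp
next
  case False
  then have "S \<subseteq> {0}" using assms(1) by auto
  then have "Gcd S = 0" by simp
  then show ?thesis using assms(2) by simp
qed

text \<open>Multiplied by \<open>1 - z\<close>, the hypothesis \<open>last_exit\<close> reads
  \<open>D * T = 1\<close>, so the decay of \<open>d\<close> is governed by the zeros of
  \<open>T\<close>, none of which lies in the closed unit disc. The limit of \<open>u\<close> is
  \<open>1 / suminf t\<close>, the reciprocal of the mean return time.\<close>

lemma renewal_sequence_exponential:
  fixes u t :: "nat \<Rightarrow> real"
  assumes last_exit: "\<And>n. (\<Sum>j\<le>n. u j * t (n - j)) = 1"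
    and t0: "t 0 = 1" and t_nonneg: "\<And>n. t n \<ge> 0" and t_dec: "decseq t"
    and c: "c > 0" and t_exp: "\<And>n. t n \<le> C * exp (- c * real n)"
    and gcd: "Gcd {n. n \<ge> 1 \<and> u n > 0} = 1"
  shows "\<exists>d r L. r > 1 \<and> summable (\<lambda>n. \<bar>d n\<bar> * r ^ n) \<and> (\<forall>n. u n = (\<Sum>j\<le>n. d j)) \<and> u \<longlonglongrightarrow> L \<and> L > 0"
proof -
  define d where "d n = (if n = 0 then u 0 else u n - u (n - 1))" for n
  have ud: "u n = (\<Sum>j\<le>n. d j)" for n
    by (induction n) (auto simp: d_def)
  define T :: "complex fps" where "T = Abs_fps (\<lambda>n. of_real (t n))"
  define U :: "complex fps" where "U = Abs_fps (\<lambda>n. of_real (u n))"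
  define D :: "complex fps" where "D = Abs_fps (\<lambda>n. of_real (d n))"
  \<comment> \<open>\<open>f\<close> is the law of the return time with tails \<open>t\<close>. The
    renewal equation \<open>U = 1 + U * F\<close> yields \<open>u \<ge> 0\<close> and later
    transfers information from the support of \<open>f\<close> to that of \<open>u\<close>.\<close>
  define f where "f n = (if n = 0 then 0 else t (n - 1) - t n)" for n
  define F :: "complex fps" where "F = Abs_fps (\<lambda>n. of_real (f n))"
  have nth_1X: "fps_nth ((1 - fps_X) * G) n = (if n = 0 then fps_nth G 0 else fps_nth G n - fps_nth G (n - 1))"
    for G :: "complex fps" and n
    by (simp add: left_diff_distrib)
  have D: "D = (1 - fps_X) * U"
    by (intro fps_ext, subst nth_1X) (auto simp: D_def U_def d_def)
  have UT: "(1 - fps_X) * (U * T) = 1"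
  proof -
    have *: "fps_nth (U * T) n = 1" for n
    proof -
      have "fps_nth (U * T) n = of_real (\<Sum>j\<le>n. u j * t (n - j))"
        by (simp add: fps_mult_nth U_def T_def atLeast0AtMost)
      then show ?thesis using last_exit by simp
    qed
    show ?thesis
      by (intro fps_ext, subst nth_1X, unfold *) simp
  qed
  have DT: "D * T = 1" using UT by (simp add: D mult.assoc)
  have T0: "fps_nth T 0 = 1" by (simp add: T_def t0)
  have Dinv: "D = inverse T"
    using DT T0 by (metis fps_inverse_unique mult.commute)
  have F1: "F = 1 - (1 - fps_X) * T"
  proof (rule fps_ext)
    fix n
    have "fps_nth ((1 - fps_X) * T) n = (if n = 0 then fps_nth T 0 else fps_nth T n - fps_nth T (n - 1))"
      by (rule nth_1X)
    then show "fps_nth F n = fps_nth (1 - (1 - fps_X) * T) n"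
      by (auto simp: F_def f_def T_def t0)
  qed
  have U_ren: "U = 1 + U * F"
    using UT by (simp add: F1 algebra_simps)
  have f_nonneg: "f n \<ge> 0" for n
    using t_dec by (auto simp: f_def decseq_def)
  have u_nonneg: "u n \<ge> 0" and u_conv: "n > 0 \<Longrightarrow> u n = (\<Sum>j\<le>n. u j * f (n - j))" for n
  proof -
    have rec: "u n = (\<Sum>j\<le>n. u j * f (n - j))" if "n > 0" for n
    proof -
      have "fps_nth U n = fps_nth (1 + U * F) n"
        using U_ren by simp
      also have "\<dots> = of_real (\<Sum>j\<le>n. u j * f (n - j))"
        using that by (simp add: fps_mult_nth U_def F_def atLeast0AtMost)
      finally have "of_real (u n) = (of_real (\<Sum>j\<le>n. u j * f (n - j)) :: complex)"
        by (simp add: U_def)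
      then show ?thesis by (simp only: of_real_eq_iff)
    qed
    have u0: "u 0 = 1" using last_exit[of 0] t0 by simp
    show "u n \<ge> 0"
    proof (induction n rule: less_induct)
      case (less n)
      show ?case
      proof (cases "n = 0")
        case False
        have "0 \<le> u j * f (n - j)" if "j \<le> n" for j
        proof (cases "j = n")
          case True then show ?thesis by (simp add: f_def)
        next
          case False with that show ?thesis using less f_nonneg by simp
        qed
        then have "0 \<le> (\<Sum>j\<le>n. u j * f (n - j))" by (intro sum_nonneg) auto
        then show ?thesis using False rec[of n] by simp
      qed (simp add: u0)
    qed
    show "n > 0 \<Longrightarrow> u n = (\<Sum>j\<le>n. u j * f (n - j))" by (rule rec)
  qed
  have C0: "C > 0" using t_exp[of 0] t0 by simp
  have tsum: "summable (\<lambda>n. t n * x ^ n)" if "x \<ge> 0" "x < exp c" for x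
  proof (rule summable_comparison_test')
    show "summable (\<lambda>n. C * (x / exp c) ^ n)"
      using that by (intro summable_mult summable_geometric) simp
    fix n
    have "t n * x ^ n \<le> C * exp (- c * real n) * x ^ n"
      using that t_exp by (intro mult_right_mono) auto
    also have "\<dots> = C * (x / exp c) ^ n"
      by (simp add: power_divide exp_minus field_simps flip: exp_of_nat_mult)
    finally show "norm (t n * x ^ n) \<le> C * (x / exp c) ^ n"
      using that t_nonneg by simp
  qed
  have radT: "fps_conv_radius T \<ge> exp c"
    unfolding fps_conv_radius_def
  proof (rule conv_radius_geI_ex')
    fix r :: real assume r: "0 < r" "ereal r < ereal (exp c)"
    have "summable (\<lambda>n. norm (fps_nth T n * complex_of_real r ^ n))"
      using tsum[of r] r t_nonneg by (simp add: T_def norm_mult norm_power)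
    then show "summable (\<lambda>n. fps_nth T n * complex_of_real r ^ n)"
      by (rule summable_norm_cancel)
  qed
  have Tsums: "(\<lambda>n. of_real (t n) * z ^ n) sums eval_fps T z" if "norm z < exp c" for z :: complex
  proof -
    have "ereal (norm z) < fps_conv_radius T" using that radT
      by (meson ereal_less_eq(3) less_ereal.simps(1) less_le_trans)
    from sums_eval_fps[OF this] show ?thesis by (simp add: T_def)
  qed
  \<comment> \<open>If \<open>T(z) = 0\<close>, then \<open>F(z) = 1 - (1 - z) T(z) = 1\<close>,
    although \<open>f\<close> is a probability sequence and \<open>z\<close> lies in the closed
    disc. Equality forces \<open>z ^ n = 1\<close> wherever \<open>f n > 0\<close>, by the renewal
    equation also wherever \<open>u n > 0\<close>, so \<open>z = 1\<close> by the gcd hypothesis;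
    but \<open>T(1) \<ge> t 0 = 1\<close>.\<close>
  have nz: "eval_fps T z \<noteq> 0" if z: "norm z \<le> 1" for z
  proof
    assume ev0: "eval_fps T z = 0"
    have ec: "exp c > 1" using c by simp
    have zc: "norm z < exp c" using z ec by linarith
    have t_lim: "t \<longlonglongrightarrow> 0"
      using summable_LIMSEQ_zero[OF tsum[of 1]] ec by simp
    have f_sums: "f sums 1"
    proof -
      have "(\<lambda>n. f (Suc n)) sums (t 0 - 0)"
        using telescope_sums'[OF t_lim] by (simp add: f_def)
      then show ?thesis using t0 by (subst (asm) sums_Suc_iff) (simp add: f_def)
    qed
    have F_sums: "(\<lambda>n. of_real (f n) * z ^ n) sums 1"
    proof -
      have "(\<lambda>n. of_real (f (Suc n)) * z ^ Suc n) sums (z * 0 - (0 - 1))"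
      proof -
        have a: "(\<lambda>n. z * (of_real (t n) * z ^ n)) sums (z * 0)"
          using sums_mult[OF Tsums[OF zc]] ev0 by simp
        have "(\<lambda>n. of_real (t n) * z ^ n) sums 0" using Tsums[OF zc] ev0 by simp
        then have b: "(\<lambda>n. of_real (t (Suc n)) * z ^ Suc n) sums (0 - 1)"
          by (subst sums_Suc_iff) (simp add: t0)
        from sums_diff[OF a b] show ?thesis by (simp add: f_def algebra_simps)
      qed
      then show ?thesis by (subst (asm) sums_Suc_iff) (simp add: f_def)
    qed
    have Re_sums: "(\<lambda>n. f n * (1 - Re (z ^ n))) sums 0"
    proof -
      have "(\<lambda>n. Re (of_real (f n) * z ^ n)) sums 1"
        using sums_Re[OF F_sums] by simp
      from sums_diff[OF f_sums this] show ?thesis by (simp add: algebra_simps)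
    qed
    have zn: "norm (z ^ n) \<le> 1" for n using z by (simp add: norm_power power_le_one)
    have Re_le: "Re (z ^ n) \<le> 1" for n
      using zn[of n] complex_Re_le_cmod[of "z ^ n"] by linarith
    have "f n * (1 - Re (z ^ n)) = 0" for n
    proof -
      have "\<forall>n. f n * (1 - Re (z ^ n)) = 0"
        using Re_sums Re_le f_nonneg
        by (subst suminf_eq_zero_iff[symmetric]) (auto simp: sums_iff)
      then show ?thesis by blast
    qed
    then have f_root: "z ^ n = 1" if "f n > 0" for n
      using unit_circle_real_part_eq_1[OF zn[of n]] that
      by (metis diff_gt_0_iff_gt eq_iff_diff_eq_0 less_irrefl mult_eq_0_iff)
    have u_root: "u n > 0 \<Longrightarrow> z ^ n = 1" for n
    proof (induction n rule: less_induct)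
      case (less n)
      show ?case
      proof (cases "n = 0")
        case False
        then have "(\<Sum>j\<le>n. u j * f (n - j)) > 0" using u_conv[of n] less.prems by simp
        then have "\<not> (\<forall>j\<in>{..n}. u j * f (n - j) \<le> 0)"
          using sum_nonpos[of "{..n}" "\<lambda>j. u j * f (n - j)"] by auto
        then obtain j where j: "j \<le> n" "u j * f (n - j) > 0"
          by (auto simp: not_le)
        then have "f (n - j) > 0" "u j > 0"
          using u_nonneg[of j] f_nonneg[of "n - j"] by (auto simp: zero_less_mult_iff)
        moreover have "j \<noteq> n" using \<open>f (n - j) > 0\<close> by (auto simp: f_def)
        ultimately have "z ^ j = 1" "z ^ (n - j) = 1" using less.IH[of j] f_root j by auto
        then show ?thesis using j(1) by (metis le_add_diff_inverse mult_1 power_add)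
      qed simp
    qed
    have z1: "z = 1"
      by (rule roots_of_unity_gcd[OF _ gcd]) (use u_root in auto)
    have "(\<lambda>n. of_real (t n) :: complex) sums 0" using Tsums[OF zc] ev0 z1 by simp
    then have "t sums 0" using sums_of_real_iff by fastforce
    then have "t 0 = 0" using suminf_eq_zero_iff[of t] t_nonneg by (auto simp: sums_iff)
    then show False using t0 by simp
  qed
  \<comment> \<open>The zeros in a closed disc inside the disc of convergence form a compact set, so
    their least modulus is attained and exceeds 1.\<close>
  obtain r where r: "r > 1" "r \<le> exp c" "\<And>z. norm z < r \<Longrightarrow> eval_fps T z \<noteq> 0"
  proof -
    define r0 where "r0 = (1 + exp c) / 2"
    have r0: "1 < r0" "r0 < exp c" using c by (auto simp: r0_def)
    define Z where "Z = {z \<in> cball 0 r0. eval_fps T z = 0}"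
    have cont: "continuous_on (cball 0 r0) (eval_fps T)"
    proof (rule continuous_on_subset[OF continuous_on_eval_fps])
      show "cball 0 r0 \<subseteq> eball 0 (fps_conv_radius T)"
        using r0 radT by (auto simp: in_eball_iff dist_norm) (meson ereal_less_eq(3) le_less_trans less_ereal.simps(1) less_le_trans)
    qed
    have "closed Z"
    proof -
      have "closed (cball 0 r0 \<inter> eval_fps T -` {0})"
        by (intro continuous_closed_preimage cont) auto
      moreover have "cball 0 r0 \<inter> eval_fps T -` {0} = Z" by (auto simp: Z_def)
      ultimately show ?thesis by simp
    qed
    then have "compact Z"
      unfolding compact_eq_bounded_closed
      by (intro conjI bounded_subset[OF bounded_cball, of _ 0 r0]) (auto simp: Z_def)
    show ?thesis
    proof (cases "Z = {}")
      case True
      then show ?thesis using that[of r0] r0 by (force simp: Z_def)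
    next
      case False
      then obtain z0 where z0: "z0 \<in> Z" "\<And>z. z \<in> Z \<Longrightarrow> norm z0 \<le> norm z"
        using continuous_attains_inf[OF \<open>compact Z\<close>, of norm] continuous_on_norm_id by blast
      have "norm z0 > 1" using nz[of z0] z0(1) by (force simp: Z_def)
      moreover have "eval_fps T z \<noteq> 0" if "norm z < min r0 (norm z0)" for z
        using that z0(2)[of z] by (auto simp: Z_def)
      ultimately show ?thesis
        using that[of "min r0 (norm z0)"] r0 by auto
    qed
  qed
  have radD: "fps_conv_radius D \<ge> ereal r"
  proof -
    have "min (ereal r) (fps_conv_radius T) \<le> fps_conv_radius (inverse T)"
      by (rule fps_conv_radius_inverse) (use r(3) in auto)
    moreover have "ereal r \<le> fps_conv_radius T" using r(2) radT by (meson ereal_less_eq(3) order_trans)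
    ultimately show ?thesis by (simp add: Dinv min_def split: if_splits)
  qed
  \<comment> \<open>Absolute convergence is guaranteed only strictly inside the disc of radius
    \<open>r\<close>.\<close>
  define r1 where "r1 = (1 + r) / 2"
  have r1: "1 < r1" "r1 < r" using r by (auto simp: r1_def)
  have "summable (\<lambda>n. norm (fps_nth D n * complex_of_real r1 ^ n))"
    by (rule abs_summable_in_conv_radius)
       (use r1 radD in \<open>auto simp: fps_conv_radius_def intro: less_le_trans[of _ "ereal r"]\<close>)
  then have dsum: "summable (\<lambda>n. \<bar>d n\<bar> * r1 ^ n)"
    using r1 by (simp add: D_def norm_mult norm_power)
  have ev1: "eval_fps D 1 * eval_fps T 1 = 1"
  proof -
    have "eval_fps (D * T) 1 = eval_fps D 1 * eval_fps T 1"
    proof (rule eval_fps_mult)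
      show "ereal (norm (1::complex)) < fps_conv_radius D"
        using r(1) by (intro less_le_trans[OF _ radD]) simp
      show "ereal (norm (1::complex)) < fps_conv_radius T"
        using c by (intro less_le_trans[OF _ radT]) simp
    qed
    then show ?thesis by (simp add: DT)
  qed
  have Dsums: "(\<lambda>n. of_real (d n) :: complex) sums eval_fps D 1"
  proof -
    have "ereal (norm (1::complex)) < fps_conv_radius D"
      using r(1) by (intro less_le_trans[OF _ radD]) simp
    from sums_eval_fps[OF this] show ?thesis by (simp add: D_def)
  qed
  have T1: "(\<lambda>n. of_real (t n) :: complex) sums eval_fps T 1"
    using Tsums[of 1] c by simp
  have tS: "summable t" using tsum[of 1] c by simp
  then have T1': "eval_fps T 1 = of_real (suminf t)"
    using T1 by (metis sums_of_real sums_unique2 summable_sums)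
  have St: "suminf t \<ge> 1"
    using sum_le_suminf[OF tS, of "{0}"] t_nonneg t0 by simp
  have dS: "summable d"
  proof (rule summable_comparison_test'[OF dsum])
    show "norm (d n) \<le> \<bar>d n\<bar> * r1 ^ n" for n
      using r1 by (simp add: mult_le_cancel_left1)
  qed
  then have D1': "eval_fps D 1 = of_real (suminf d)"
    using Dsums by (metis sums_of_real sums_unique2 summable_sums)
  have "suminf d * suminf t = 1"
    using ev1 unfolding T1' D1' of_real_mult[symmetric] by (simp only: of_real_eq_1_iff)
  then have "suminf d = 1 / suminf t" using St by (simp add: field_simps)
  then have "suminf d > 0" using St by simp
  moreover have "u \<longlonglongrightarrow> suminf d"
    using summable_LIMSEQ'[OF dS] unfolding ud[symmetric] .
  ultimately show ?thesis using r1(1) dsum ud by blast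
qed

section \<open>Markov kernels and the last-exit decomposition\<close>

definition kernel_pmf :: "('a::countable \<Rightarrow> 'a \<Rightarrow> real) \<Rightarrow> 'a \<Rightarrow> 'a pmf" where
  "kernel_pmf P x = embed_pmf (P x)"

section \<open>Countable sums and probability mass functions\<close>

lemma has_sum_nn_integral_count_space:
  fixes f :: "'a \<Rightarrow> real"
  assumes "(f has_sum S) UNIV" "\<And>x. f x \<ge> 0"
  shows "(\<integral>\<^sup>+x. ennreal (f x) \<partial>count_space UNIV) = ennreal S"
proof -
  have "f summable_on UNIV" using assms(1) by (auto simp: summable_on_def)
  then have "Infinite_Set_Sum.abs_summable_on f UNIV"
    using assms(2) by (simp flip: abs_summable_equivalent)
  then have "(\<integral>\<^sup>+x. ennreal (f x) \<partial>count_space UNIV) = ennreal (infsetsum f UNIV)"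
    using assms(2) by (simp add: nn_integral_conv_infsetsum)
  also have "infsetsum f UNIV = S"
    using \<open>Infinite_Set_Sum.abs_summable_on f UNIV\<close> assms(1) by (simp add: infsetsum_infsum infsumI)
  finally show ?thesis .
qed

lemma has_sum_diff_real:
  fixes f g :: "'a \<Rightarrow> real"
  assumes "(f has_sum a) A" "(g has_sum b) A"
  shows "((\<lambda>x. f x - g x) has_sum (a - b)) A"
  using has_sum_add[OF assms(1) has_sum_uminusI[OF assms(2)]] by simp

lemma has_sum_finite_sum:
  fixes f :: "'i \<Rightarrow> 'a \<Rightarrow> real"
  assumes "finite I" "\<And>i. i \<in> I \<Longrightarrow> (f i has_sum S i) A"
  shows "((\<lambda>x. \<Sum>i\<in>I. f i x) has_sum (\<Sum>i\<in>I. S i)) A"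
  using assms by (induction I rule: finite_induct) (auto intro: has_sum_add)

lemma embed_pmf_has_sum:
  fixes f :: "'a \<Rightarrow> real"
  assumes "(f has_sum 1) UNIV" "\<And>x. f x \<ge> 0"
  shows "pmf (embed_pmf f) x = f x"
  by (rule pmf_embed_pmf) (use assms has_sum_nn_integral_count_space[OF assms] in simp_all)

text \<open>The product form covers \<open>S = 0\<close>, where \<open>f\<close> vanishes and any
  pmf will do. Conditional laws given null events can thus be chosen arbitrarily without a case
  distinction at each use.\<close>

lemma ex_pmf_normalized:
  fixes f :: "'a \<Rightarrow> real"
  assumes f: "(f has_sum S) UNIV" "\<And>x. f x \<ge> 0"
  shows "\<exists>p. \<forall>x. pmf p x * S = f x"
proof (cases "S = 0")
  case True
  then have "f x = 0" for x using nonneg_has_sum_le_0D[of f UNIV S x] f by auto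
  then show ?thesis using True by simp
next
  case False
  with has_sum_nonneg[OF f(1)] f(2) have S: "S > 0" by fastforce
  have "((\<lambda>x. f x / S) has_sum 1) UNIV"
    using has_sum_divide_const[OF f(1), of S] S by simp
  from embed_pmf_has_sum[OF this] S f(2) show ?thesis
    by (intro exI[of _ "embed_pmf (\<lambda>x. f x / S)"]) simp
qed

lemma has_sum_pmf_expectation:
  fixes p :: "'a pmf" and g :: "'a \<Rightarrow> real"
  assumes "\<And>x. \<bar>g x\<bar> \<le> B"
  shows "((\<lambda>x. pmf p x * g x) has_sum measure_pmf.expectation p g) UNIV"
proof -
  have int: "integrable (measure_pmf p) g"
    by (rule measure_pmf.integrable_const_bound[of _ B]) (use assms in auto)
  have a: "Infinite_Set_Sum.abs_summable_on (\<lambda>x. pmf p x * g x) UNIV"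
  proof (rule abs_summable_on_comparison_test')
    show "Infinite_Set_Sum.abs_summable_on (\<lambda>x. pmf p x * B) UNIV"
      by (intro abs_summable_on_cmult_left pmf_abs_summable)
    show "norm (pmf p x * g x) \<le> pmf p x * B" for x
      using assms[of x] by (simp add: abs_mult mult_left_mono)
  qed
  have "measure_pmf.expectation p g = infsetsum (\<lambda>x. pmf p x * g x) UNIV"
    by (rule pmf_expectation_eq_infsetsum)
  also have "\<dots> = infsum (\<lambda>x. pmf p x * g x) UNIV"
    using a by (simp add: infsetsum_infsum)
  finally show ?thesis
    using a by (metis abs_summable_equivalent abs_summable_summable has_sum_infsum)
qed

lemma has_sum_pmf: "(pmf p has_sum 1) UNIV"
  using has_sum_pmf_expectation[of "\<lambda>_. 1" 1 p] by simp

section \<open>Iterates of the kernel and avoidance probabilities\<close>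

locale markov_kernel =
  fixes P :: "'a::countable \<Rightarrow> 'a \<Rightarrow> real"
  assumes stoch: "stochastic_matrix P"
begin

abbreviation "K \<equiv> kernel_pmf P"

lemma pmf_K [simp]: "pmf (K x) y = P x y"
  unfolding kernel_pmf_def
  by (rule embed_pmf_has_sum) (use stoch in \<open>auto simp: stochastic_matrix_def\<close>)

lemma P_nonneg: "P x y \<ge> 0" and P_le_1: "P x y \<le> 1"
  using pmf_nonneg[of "K x" y] pmf_le_1[of "K x" y] by auto

lemma has_sum_P: "(P x has_sum 1) UNIV"
  using stoch by (auto simp: stochastic_matrix_def)

primrec step_pmf :: "nat \<Rightarrow> 'a \<Rightarrow> 'a pmf" where
  "step_pmf 0 = return_pmf"
| "step_pmf (Suc n) = (\<lambda>x. bind_pmf (K x) (step_pmf n))"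

lemma step_pmf_Suc': "step_pmf (Suc n) x = bind_pmf (step_pmf n x) K"
proof (induction n arbitrary: x)
  case (Suc n)
  from Suc have "bind_pmf (K y) (step_pmf n) = bind_pmf (step_pmf n y) K" for y by simp
  then show ?case
    unfolding step_pmf.simps(2) bind_assoc_pmf by (simp only:)
qed (simp add: bind_return_pmf bind_return_pmf')

lemma pmf_bind_has_sum: "((\<lambda>y. pmf p y * pmf (q y) x) has_sum pmf (bind_pmf p q) x) UNIV"
  unfolding pmf_bind by (rule has_sum_pmf_expectation[of _ 1]) (simp add: pmf_le_1)

lemma nstep_eq: "nstep P n x y = pmf (step_pmf n x) y"
proof (induction n arbitrary: x)
  case (Suc n)
  have "nstep P (Suc n) x y = (\<Sum>\<^sub>\<infinity>z. pmf (K x) z * pmf (step_pmf n z) y)"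
    by (simp add: Suc)
  also have "\<dots> = pmf (step_pmf (Suc n) x) y"
    by (simp del: pmf_K add: infsumI[OF pmf_bind_has_sum])
  finally show ?case .
qed (auto simp: pmf_return)

text \<open>\<open>avoid P s n x\<close> tests the times 1 to \<open>n\<close> and is blind to the
  starting state; here time 0 is tested as well. This turns the sum over states other than
  \<open>s\<close> into an expectation under the kernel.\<close>

definition avoid_from_start where "avoid_from_start s n x = (if x = s then 0 else avoid P s n x)"

lemma avoid_Suc: 
  assumes "\<And>x. \<bar>avoid P s n x\<bar> \<le> 1"
  shows "((\<lambda>y. P x y * avoid_from_start s n y) has_sum avoid P s (Suc n) x) UNIV"
proof -
  have "((\<lambda>y. pmf (K x) y * avoid_from_start s n y) has_sum measure_pmf.expectation (K x) (avoid_from_start s n)) UNIV"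
    by (rule has_sum_pmf_expectation[of _ 1]) (use assms in \<open>auto simp: avoid_from_start_def\<close>)
  then have h: "((\<lambda>y. P x y * avoid_from_start s n y) has_sum measure_pmf.expectation (K x) (avoid_from_start s n)) UNIV" by simp
  have "avoid P s (Suc n) x = (\<Sum>\<^sub>\<infinity>y. P x y * avoid_from_start s n y)"
    unfolding avoid.simps by (rule infsum_cong_neutral) (auto simp: avoid_from_start_def)
  with h show ?thesis by (simp add: infsumI)
qed

lemma avoid_bounds: "avoid P s n x \<ge> 0 \<and> avoid P s n x \<le> 1"
proof (induction n arbitrary: x)
  case (Suc n)
  then have h: "((\<lambda>y. P x y * avoid_from_start s n y) has_sum avoid P s (Suc n) x) UNIV"
    by (intro avoid_Suc) (auto simp: abs_le_iff intro: order_trans[of _ 0])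
  have "0 \<le> P x y * avoid_from_start s n y" "P x y * avoid_from_start s n y \<le> P x y" for y
    using Suc[of y] P_nonneg[of x y] by (auto simp: avoid_from_start_def mult_left_le)
  then show ?case
    using has_sum_nonneg[OF h] has_sum_mono[OF h has_sum_P[of x]] by blast
qed simp

lemma avoid_has_sum: "((\<lambda>y. P x y * avoid_from_start s n y) has_sum avoid P s (Suc n) x) UNIV"
  by (rule avoid_Suc) (use avoid_bounds in \<open>auto simp: abs_le_iff intro: order_trans[of _ 0]\<close>)

lemma avoid_antimono: "avoid P s (Suc n) x \<le> avoid P s n x"
proof (induction n arbitrary: x)
  case 0
  then show ?case using avoid_bounds[of s "Suc 0" x] by simp
next
  case (Suc n)
  show ?case
    by (rule has_sum_mono[OF avoid_has_sum avoid_has_sum])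
       (use Suc P_nonneg in \<open>auto simp: avoid_from_start_def intro!: mult_left_mono\<close>)
qed

text \<open>The \<open>j\<close>-th summand is the probability that the last visit to
  \<open>s\<close> up to time \<open>n\<close> occurs at time \<open>j\<close>, so the sum is the
  probability of some visit during the times 0 to \<open>n\<close>. The start \<open>x\<close> is
  arbitrary because the induction conditions on the first step; the case \<open>x = s\<close> is the
  one applied.\<close>

lemma last_exit_decomposition:
  "(\<Sum>j\<le>n. nstep P j x s * avoid P s (n - j) s) = 1 - avoid_from_start s n x"
proof (induction n arbitrary: x)
  case 0
  then show ?case by (auto simp: avoid_from_start_def)
next
  case (Suc n)
  have "((\<lambda>z. \<Sum>j\<in>{..n}. P x z * nstep P j z s * avoid P s (n - j) s) has_sum
      (\<Sum>j\<le>n. nstep P (Suc j) x s * avoid P s (n - j) s)) UNIV"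
  proof (rule has_sum_finite_sum)
    fix j
    have "((\<lambda>z. P x z * nstep P j z s) has_sum nstep P (Suc j) x s) UNIV"
      unfolding nstep_eq step_pmf.simps using pmf_bind_has_sum[of "K x" "step_pmf j" s] by simp
    then show "((\<lambda>z. P x z * nstep P j z s * avoid P s (n - j) s) has_sum nstep P (Suc j) x s * avoid P s (n - j) s) UNIV"
      by (rule has_sum_cmult_left)
  qed simp
  also have "(\<lambda>z. \<Sum>j\<le>n. P x z * nstep P j z s * avoid P s (n - j) s) = (\<lambda>z. P x z - P x z * avoid_from_start s n z)"
    using Suc by (simp add: sum_distrib_left[symmetric] mult.assoc right_diff_distrib)
  finally have a: "((\<lambda>z. P x z - P x z * avoid_from_start s n z) has_sum
      (\<Sum>j\<le>n. nstep P (Suc j) x s * avoid P s (n - j) s)) UNIV" .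
  have "((\<lambda>z. P x z - P x z * avoid_from_start s n z) has_sum (1 - avoid P s (Suc n) x)) UNIV"
    by (intro has_sum_diff_real has_sum_P avoid_has_sum)
  with a have "(\<Sum>j\<le>n. nstep P (Suc j) x s * avoid P s (n - j) s) = 1 - avoid P s (Suc n) x"
    by (rule has_sum_unique)
  moreover have "(\<Sum>j\<le>Suc n. nstep P j x s * avoid P s (Suc n - j) s) =
      nstep P 0 x s * avoid P s (Suc n) s + (\<Sum>j\<le>n. nstep P (Suc j) x s * avoid P s (n - j) s)"
    by (simp only: sum.atMost_Suc_shift diff_zero diff_Suc_Suc)
  ultimately show ?case by (auto simp: avoid_from_start_def)
qed

text \<open>The tail sequence is \<open>P(T > n)\<close>, which is \<open>avoid P s n s\<close> and
  thus \<open>return_tail\<close> at \<open>Suc n\<close>.\<close>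

lemma return_probabilities_exponential:
  assumes ap: "aperiodic_chain P"
    and c: "c > 0" and tail: "\<And>n. return_tail P s n \<le> C * exp (- c * real n)"
  shows "\<exists>d r L. r > 1 \<and> summable (\<lambda>n. \<bar>d n\<bar> * r ^ n) \<and>
    (\<forall>n. nstep P n s s = (\<Sum>j\<le>n. d j)) \<and> (\<lambda>n. nstep P n s s) \<longlonglongrightarrow> L \<and> L > 0"
proof (rule renewal_sequence_exponential[where t = "\<lambda>n. avoid P s n s" and c = c and C = "C"])
  show "(\<Sum>j\<le>n. nstep P j s s * avoid P s (n - j) s) = 1" for n
    by (simp add: last_exit_decomposition avoid_from_start_def)
  show "decseq (\<lambda>n. avoid P s n s)" by (intro decseq_SucI avoid_antimono)
  have C0: "C \<ge> 0" using tail[of 0] avoid_bounds[of s 0 s] by (simp add: return_tail_def)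
  show "avoid P s n s \<le> C * exp (- c * real n)" for n
  proof -
    have "avoid P s n s \<le> C * exp (- c * real (Suc n))" using tail[of "Suc n"] by (simp add: return_tail_def)
    also have "\<dots> \<le> C * exp (- c * real n)" using C0 c by (intro mult_left_mono) auto
    finally show ?thesis .
  qed
  show "Gcd {n. 1 \<le> n \<and> 0 < nstep P n s s} = 1" using ap by (auto simp: aperiodic_chain_def)
qed (use c avoid_bounds in auto)

text \<open>Serves to identify the one-time law of the constructed process with that of the given
  chain. Both laws have mass 1, so a difference of constant sign vanishes and only a change of sign
  has to be excluded.\<close>

lemma stationary_unique:
  assumes irr: "irreducible_chain P"
    and p: "bind_pmf p K = p" and q: "bind_pmf q K = q"
  shows "p = q"
proof -
  have inv: "((\<lambda>y. pmf p y * P y x) has_sum pmf p x) UNIV" if "bind_pmf p K = p" for p x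
    using pmf_bind_has_sum[of p K x] that by simp
  have n_inv: "bind_pmf p (step_pmf n) = p" if p: "bind_pmf p K = p" for p n
  proof (induction n)
    case (Suc n)
    have "bind_pmf p (step_pmf (Suc n)) = bind_pmf (bind_pmf p K) (step_pmf n)"
      by (simp add: bind_assoc_pmf)
    then show ?case by (simp add: p Suc)
  qed (simp add: bind_return_pmf')
  have inv_n: "((\<lambda>y. pmf p y * pmf (step_pmf n y) x) has_sum pmf p x) UNIV" if "bind_pmf p K = p" for p n x
    using pmf_bind_has_sum[of p "step_pmf n" x] n_inv[OF that] by simp
  text \<open>If \<open>p - q\<close> took both signs, \<open>min p q\<close> would strictly decrease under a step while its mass is preserved.\<close>
  have no_crossing: False if x: "pmf q x < pmf p x" and y: "pmf p y < pmf q y" for x y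
  proof -
    obtain n where n: "pmf (step_pmf n y) x > 0"
      using irr unfolding irreducible_chain_def nstep_eq by blast
    define m where "m z = min (pmf p z) (pmf q z)" for z
    have m_le: "m z \<le> pmf p z" "m z \<le> pmf q z" "0 \<le> m z" for z by (auto simp: m_def)
    have "m summable_on UNIV"
      by (rule summable_on_comparison_test[OF has_sum_imp_summable[OF has_sum_pmf[of p]]])
         (use m_le in auto)
    then have m_sum: "(m has_sum infsum m UNIV) UNIV" by simp
    define S where "S = infsum m UNIV"
    obtain r where r: "\<And>z. pmf r z * S = m z"
      using ex_pmf_normalized[OF m_sum m_le(3)] by (auto simp: S_def)
    have S: "S \<ge> 0" using has_sum_nonneg[OF m_sum] m_le(3) by (simp add: S_def)
    define r' where "r' = bind_pmf r (step_pmf n)"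
    have r': "((\<lambda>z. m z * pmf (step_pmf n z) w) has_sum pmf r' w * S) UNIV" for w
      using has_sum_cmult_left[OF pmf_bind_has_sum[of r "step_pmf n" w], of S]
      by (simp add: r'_def mult.assoc mult.commute[of _ S] flip: r)
    have le: "pmf r' w * S \<le> m w" for w
    proof -
      have "pmf r' w * S \<le> pmf p w"
        by (rule has_sum_mono[OF r' inv_n[OF p, of n]]) (use m_le in \<open>auto intro: mult_right_mono\<close>)
      moreover have "pmf r' w * S \<le> pmf q w"
        by (rule has_sum_mono[OF r' inv_n[OF q, of n]]) (use m_le in \<open>auto intro: mult_right_mono\<close>)
      ultimately show ?thesis by (simp add: m_def)
    qed
    \<comment> \<open>The strict loss comes from the summand \<open>y\<close>, where
      \<open>m y = pmf p y < pmf q y\<close> and \<open>x\<close> is reachable in \<open>n\<close>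
      steps. As \<open>m x = pmf q x\<close>, it is a loss relative to \<open>m\<close>.\<close>
    have "pmf r' x * S < pmf q x"
      by (rule has_sum_strict_mono[where x = y, OF r' inv_n[OF q, of n]])
         (use m_le n y in \<open>auto intro!: mult_right_mono simp: m_def\<close>)
    then have lt: "pmf r' x * S < m x" using x by (simp add: m_def)
    have "1 * S < S"
      by (rule has_sum_strict_mono[where x = x, OF has_sum_cmult_left[OF has_sum_pmf[of r']] m_sum[folded S_def]])
         (use le lt in auto)
    then show False by simp
  qed
  have diff: "((\<lambda>x. pmf p x - pmf q x) has_sum 0) UNIV" "((\<lambda>x. pmf q x - pmf p x) has_sum 0) UNIV"
    using has_sum_diff_real[OF has_sum_pmf[of p] has_sum_pmf[of q]]
      has_sum_diff_real[OF has_sum_pmf[of q] has_sum_pmf[of p]] by simp_all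
  show ?thesis
  proof (rule pmf_eqI)
    fix x
    consider "\<And>x. pmf p x \<le> pmf q x" | "\<And>x. pmf q x \<le> pmf p x"
      using no_crossing by (meson not_le)
    then show "pmf p x = pmf q x"
    proof cases
      case 1
      then show ?thesis using nonneg_has_sum_le_0D[OF diff(2), of x] by simp
    next
      case 2
      then show ?thesis using nonneg_has_sum_le_0D[OF diff(1), of x] by simp
    qed
  qed
qed

end

section \<open>Fitting the gaps between marks to the chain\<close>

text \<open>\<open>gap_tail m p k\<close> is the probability that the distance between consecutive marks exceeds \<open>k\<close>,
  where a site is marked when an i.i.d. Bernoulli(\<open>p\<close>) sequence shows a one preceded by \<open>m\<close> zeros;
  \<open>gap_prob m p k\<close> is the probability that this distance equals \<open>k + 1\<close>.\<close>

fun gap_tail :: "nat \<Rightarrow> real \<Rightarrow> nat \<Rightarrow> real" where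
  "gap_tail m p 0 = 1"
| "gap_tail m p (Suc k) = gap_tail m p k - (if m \<le> k then p * (1 - p) ^ m * gap_tail m p (k - m) else 0)"

definition gap_prob :: "nat \<Rightarrow> real \<Rightarrow> nat \<Rightarrow> real" where
  "gap_prob m p k = (if m \<le> k then p * (1 - p) ^ m * gap_tail m p (k - m) else 0)"

lemma gap_tail_Suc: "gap_tail m p (Suc k) = gap_tail m p k - gap_prob m p k"
  by (simp add: gap_prob_def)

lemma gap_tail_eq_1: "k \<le> m \<Longrightarrow> gap_tail m p k = 1"
  by (induction k) auto

text \<open>Given that no mark has appeared, the next step produces one with probability at most
  \<open>p\<close>. Iterating the ratio bound over the last \<open>m\<close> steps gives
  \<open>(1 - p) ^ m * gap_tail m p (k - m) \<le> gap_tail m p k\<close>, hence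
  \<open>gap_prob m p k \<le> p * gap_tail m p k\<close>. Because of the delay \<open>m\<close> the
  induction is a strong one.\<close>

lemma gap_tail_bounds:
  assumes p: "0 < p" "p < 1"
  shows "gap_tail m p k > 0 \<and> (1 - p) * gap_tail m p k \<le> gap_tail m p (Suc k)"
proof (induction k rule: less_induct)
  case (less k)
  have dec: "(1 - p) ^ j * gap_tail m p (k - j) \<le> gap_tail m p k" if "j \<le> k" for j
    using that
  proof (induction j)
    case (Suc j)
    have "(1 - p) * gap_tail m p (k - Suc j) \<le> gap_tail m p (Suc (k - Suc j))"
      using less[of "k - Suc j"] Suc.prems by simp
    also have "Suc (k - Suc j) = k - j" using Suc.prems by simp
    finally have "(1 - p) ^ j * ((1 - p) * gap_tail m p (k - Suc j)) \<le> (1 - p) ^ j * gap_tail m p (k - j)"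
      using p by (intro mult_left_mono) auto
    also have "\<dots> \<le> gap_tail m p k" using Suc by simp
    finally show ?case by (simp add: mult_ac)
  qed simp
  have pos: "gap_tail m p k > 0"
  proof (cases k)
    case (Suc j)
    then have "0 < (1 - p) * gap_tail m p j" "(1 - p) * gap_tail m p j \<le> gap_tail m p k"
      using less[of j] p by (auto simp del: gap_tail.simps)
    then show ?thesis by linarith
  qed simp
  have "gap_prob m p k \<le> p * gap_tail m p k"
  proof (cases "m \<le> k")
    case True
    then show ?thesis using dec[OF True] p by (simp add: gap_prob_def mult.assoc mult_left_mono)
  qed (use pos p in \<open>simp add: gap_prob_def\<close>)
  then have "(1 - p) * gap_tail m p k \<le> gap_tail m p (Suc k)"
    unfolding gap_tail_Suc by (simp add: algebra_simps)
  with pos show ?case by blast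
qed

lemma gap_tail_pos: "0 < p \<Longrightarrow> p < 1 \<Longrightarrow> gap_tail m p k > 0"
  using gap_tail_bounds by blast

lemma gap_prob_nonneg: "0 < p \<Longrightarrow> p < 1 \<Longrightarrow> gap_prob m p k \<ge> 0"
  using gap_tail_pos[of p m "k - m"] by (simp add: gap_prob_def)

lemma gap_tail_antimono: "0 < p \<Longrightarrow> p < 1 \<Longrightarrow> gap_tail m p (k + j) \<le> gap_tail m p k"
proof (induction j)
  case (Suc j)
  then show ?case using gap_prob_nonneg[of p m "k + j"] gap_tail_Suc[of m p "k + j"] by simp
qed simp

lemma gap_tail_ratio:
  assumes p: "0 < p" "p < 1"
  shows "(1 - p) ^ j * gap_tail m p k \<le> gap_tail m p (k + j)"
proof (induction j)
  case (Suc j)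
  have "(1 - p) ^ Suc j * gap_tail m p k \<le> (1 - p) * gap_tail m p (k + j)"
    using Suc p by (simp add: mult.assoc mult_left_mono)
  also have "\<dots> \<le> gap_tail m p (k + Suc j)"
    using gap_tail_bounds[OF p, of m "k + j"] by (simp del: gap_tail.simps)
  finally show ?case .
qed simp

text \<open>For \<open>k \<le> m\<close> the convolution is \<open>u k\<close>. For larger
  \<open>k\<close> it is \<open>u k * ?a k\<close> plus a correction involving
  \<open>?a (k - j) - ?a k\<close>, which is at most \<open>(g t - g 1) * ?a k\<close> in absolute
  value. Continuity of \<open>g\<close> at 1 pushes this below \<open>L / 2 * ?a k\<close>. The
  bound is uniform in \<open>m\<close>, so \<open>m\<close> and \<open>p\<close> can be chosen
  separately.\<close>

lemma convolution_gap_tail_nonneg: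
  fixes d u :: "nat \<Rightarrow> real"
  assumes u: "\<And>n. u n = (\<Sum>j\<le>n. d j)" "\<And>n. u n \<ge> 0" "u \<longlonglongrightarrow> L" "L > 0"
    and r: "r > 1" "summable (\<lambda>n. \<bar>d n\<bar> * r ^ n)"
  shows "\<exists>m p. 0 < p \<and> p < 1 \<and> (\<forall>k. (\<Sum>j\<le>k. d j * gap_tail m p (k - j)) \<ge> 0)"
proof -
  obtain m where m: "\<And>k. k > m \<Longrightarrow> u k \<ge> L / 2"
  proof -
    have "eventually (\<lambda>k. u k > L / 2) sequentially"
      using u(3,4) by (intro order_tendstoD) auto
    then show ?thesis using that unfolding eventually_sequentially
      by (meson less_imp_le less_or_eq_imp_le)
  qed
  define g where "g t = (\<Sum>n. \<bar>d n\<bar> * t ^ n)" for t :: real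
  have summ: "summable (\<lambda>n. \<bar>d n\<bar> * t ^ n)" if "0 \<le> t" "t \<le> r" for t
    by (rule summable_comparison_test'[OF r(2)])
       (use that in \<open>auto simp: abs_mult intro!: mult_left_mono power_mono\<close>)
  have "isCont g 1"
    unfolding g_def by (rule isCont_powser[OF r(2)]) (use r in auto)
  then have "eventually (\<lambda>t. g t < g 1 + L / 2) (at 1)"
    using u(4) by (intro order_tendstoD[of g "g 1"]) (auto simp: isCont_def)
  then have "eventually (\<lambda>t. g t < g 1 + L / 2) (at_right 1)"
    by (rule eventually_at_split[THEN iffD1, THEN conjunct2])
  moreover have "eventually (\<lambda>t. t \<in> {1<..<r}) (at_right (1::real))"
    using r(1) by (rule eventually_at_right_real)
  ultimately have "eventually (\<lambda>t. g t < g 1 + L / 2 \<and> t \<in> {1<..<r}) (at_right 1)"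
    by (rule eventually_conj)
  then obtain t where t: "g t < g 1 + L / 2" "1 < t" "t < r"
    using eventually_happens[of _ "at_right (1::real)"] by auto
  define p where "p = 1 - 1 / t"
  have p: "0 < p" "p < 1" using t by (auto simp: p_def)
  let ?a = "gap_tail m p"
  have "(\<Sum>j\<le>k. d j * ?a (k - j)) \<ge> 0" for k
  proof (cases "k \<le> m")
    case True
    then have "(\<Sum>j\<le>k. d j * ?a (k - j)) = u k"
      by (simp add: gap_tail_eq_1 u)
    then show ?thesis using u(2) by simp
  next
    case False
    have bound: "\<bar>d j\<bar> * (?a (k - j) - ?a k) \<le> (\<bar>d j\<bar> * t ^ j - \<bar>d j\<bar> * 1 ^ j) * ?a k" if "j \<le> k" for j
    proof -
      have "(1 / t) ^ j * ?a (k - j) \<le> ?a k"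
        using gap_tail_ratio[OF p, of j m "k - j"] that by (simp add: p_def)
      then have "?a (k - j) \<le> t ^ j * ?a k"
        using t by (simp add: power_divide field_simps)
      then have "\<bar>d j\<bar> * (?a (k - j) - ?a k) \<le> \<bar>d j\<bar> * ((t ^ j - 1) * ?a k)"
        by (intro mult_left_mono) (auto simp: algebra_simps)
      then show ?thesis by (simp add: algebra_simps)
    qed
    have "(\<Sum>j\<le>k. d j * ?a (k - j)) = u k * ?a k + (\<Sum>j\<le>k. d j * (?a (k - j) - ?a k))"
      by (simp add: u(1) sum_distrib_right right_diff_distrib sum_subtractf)
    also have "\<dots> \<ge> u k * ?a k - (\<Sum>j\<le>k. \<bar>d j\<bar> * (?a (k - j) - ?a k))"
    proof -
      have "- (\<bar>d j\<bar> * (?a (k - j) - ?a k)) \<le> d j * (?a (k - j) - ?a k)" if "j \<le> k" for j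
      proof -
        have "?a (k - j) - ?a k \<ge> 0" using gap_tail_antimono[OF p, of m "k - j" j] that by simp
        then show ?thesis by (metis abs_ge_minus_self abs_mult abs_of_nonneg minus_le_iff)
      qed
      then have "(\<Sum>j\<le>k. - (\<bar>d j\<bar> * (?a (k - j) - ?a k))) \<le> (\<Sum>j\<le>k. d j * (?a (k - j) - ?a k))"
        by (intro sum_mono) auto
      then show ?thesis by (simp add: sum_negf)
    qed
    also have "u k * ?a k - (\<Sum>j\<le>k. \<bar>d j\<bar> * (?a (k - j) - ?a k)) \<ge> 0"
    proof -
      have "(\<Sum>j\<le>k. \<bar>d j\<bar> * (?a (k - j) - ?a k)) \<le> (\<Sum>j\<le>k. (\<bar>d j\<bar> * t ^ j - \<bar>d j\<bar> * 1 ^ j) * ?a k)"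
        using bound by (intro sum_mono) auto
      also have "\<dots> = (\<Sum>j\<le>k. \<bar>d j\<bar> * t ^ j - \<bar>d j\<bar> * 1 ^ j) * ?a k"
        by (simp add: sum_distrib_right)
      also have "\<dots> \<le> (g t - g 1) * ?a k"
      proof (rule mult_right_mono)
        have s: "summable (\<lambda>j. \<bar>d j\<bar> * t ^ j)" "summable (\<lambda>j. \<bar>d j\<bar> * 1 ^ j)"
          using summ[of t] summ[of 1] t r by auto
        show "(\<Sum>j\<le>k. \<bar>d j\<bar> * t ^ j - \<bar>d j\<bar> * 1 ^ j) \<le> g t - g 1"
          unfolding g_def suminf_diff[OF s]
          by (rule sum_le_suminf[OF summable_diff[OF s]]) (use t in \<open>auto simp: mult_le_cancel_left1\<close>)
      qed (use gap_tail_pos[OF p, of m k] in simp)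
      also have "\<dots> \<le> u k * ?a k"
        using t(1) m[of k] False gap_tail_pos[OF p, of m k] by (intro mult_right_mono) auto
      finally show ?thesis by simp
    qed
    finally show ?thesis by simp
  qed
  then show ?thesis using p by blast
qed

section \<open>Mass of the chain by age since the last mark\<close>

context markov_kernel
begin

text \<open>\<open>age_mass s m p k x\<close> is the probability that \<open>x\<close> is the state \<open>k\<close> steps after a mark and no
  further mark has appeared, when the marks are placed on visits to \<open>s\<close>.\<close>

definition age_mass :: "'a \<Rightarrow> nat \<Rightarrow> real \<Rightarrow> nat \<Rightarrow> 'a \<Rightarrow> real" where
  "age_mass s m p k x = pmf (step_pmf k s) x - (\<Sum>j<k. gap_prob m p j * pmf (step_pmf (k - Suc j) s) x)"

lemma age_mass_0: "age_mass s m p 0 x = (if x = s then 1 else 0)"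
  by (simp add: age_mass_def pmf_return)

lemma age_mass_total: "(age_mass s m p k has_sum gap_tail m p k) UNIV"
proof -
  have "(age_mass s m p k has_sum (1 - (\<Sum>j<k. gap_prob m p j * 1))) UNIV"
    unfolding age_mass_def[abs_def]
    by (intro has_sum_diff_real has_sum_finite_sum has_sum_cmult_right has_sum_pmf) auto
  moreover have "1 - (\<Sum>j<k. gap_prob m p j * 1) = gap_tail m p k"
    by (induction k) (simp_all add: gap_tail_Suc del: gap_tail.simps(2))
  ultimately show ?thesis by simp
qed

text \<open>One step from age \<open>k\<close> leads either to age \<open>Suc k\<close> or to a
  mark. The mass \<open>gap_prob m p k\<close> of the second case sits at \<open>s\<close>, since
  \<open>age_mass s m p 0\<close> is the point mass there.\<close>

lemma age_mass_step:
  "((\<lambda>y. age_mass s m p k y * P y x) has_sum (age_mass s m p (Suc k) x + gap_prob m p k * age_mass s m p 0 x)) UNIV"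
proof -
  have st: "((\<lambda>y. pmf (step_pmf n s) y * P y x) has_sum pmf (step_pmf (Suc n) s) x) UNIV" for n
    unfolding step_pmf_Suc' using pmf_bind_has_sum[of "step_pmf n s" K x] by simp
  have "((\<lambda>y. pmf (step_pmf k s) y * P y x - (\<Sum>j\<in>{..<k}. gap_prob m p j * (pmf (step_pmf (k - Suc j) s) y * P y x)))
     has_sum (pmf (step_pmf (Suc k) s) x - (\<Sum>j\<in>{..<k}. gap_prob m p j * pmf (step_pmf (Suc (k - Suc j)) s) x))) UNIV"
    by (intro has_sum_diff_real has_sum_finite_sum has_sum_cmult_right st) auto
  moreover have "pmf (step_pmf (Suc k) s) x - (\<Sum>j\<in>{..<k}. gap_prob m p j * pmf (step_pmf (Suc (k - Suc j)) s) x)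
     = age_mass s m p (Suc k) x + gap_prob m p k * age_mass s m p 0 x"
    by (auto simp: age_mass_def Suc_diff_Suc simp del: step_pmf.simps(2) intro!: sum.cong)
  ultimately show ?thesis
    by (simp add: age_mass_def left_diff_distrib sum_distrib_right mult.assoc)
qed

text \<open>In generating functions the definition gives \<open>H = (1 - z G) U\<close>, and the
  recursion for the tails gives \<open>(1 - z) A = 1 - z G\<close>. Together
  \<open>H = (1 - z) U A = D A\<close>.\<close>

lemma age_mass_at_s:
  assumes "\<And>n. nstep P n s s = (\<Sum>j\<le>n. d j)"
  shows "age_mass s m p k s = (\<Sum>j\<le>k. d j * gap_tail m p (k - j))"
proof -
  define U D A G H where
    "U = Abs_fps (\<lambda>n. nstep P n s s)" and "D = Abs_fps d" and "A = Abs_fps (gap_tail m p)"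
    and "G = Abs_fps (gap_prob m p)" and "H = Abs_fps (\<lambda>k. age_mass s m p k s)"
  have nth_1X: "fps_nth ((1 - fps_X) * F) n = (if n = 0 then fps_nth F 0 else fps_nth F n - fps_nth F (n - 1))"
    for F :: "real fps" and n
    by (simp add: left_diff_distrib)
  have D: "D = (1 - fps_X) * U"
  proof (rule fps_ext)
    fix n show "fps_nth D n = fps_nth ((1 - fps_X) * U) n"
      by (cases n; subst nth_1X) (auto simp: D_def U_def assms simp del: nstep.simps)
  qed
  have A: "(1 - fps_X) * A = 1 - fps_X * G"
  proof (rule fps_ext)
    fix n show "fps_nth ((1 - fps_X) * A) n = fps_nth (1 - fps_X * G) n"
      by (cases n; subst nth_1X) (auto simp: A_def G_def gap_tail_Suc simp del: gap_tail.simps(2))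
  qed
  have H: "H = U - fps_X * (G * U)"
  proof (rule fps_ext)
    fix n show "fps_nth H n = fps_nth (U - fps_X * (G * U)) n"
    proof (cases n)
      case (Suc k)
      have "(\<Sum>j<Suc k. gap_prob m p j * pmf (step_pmf (k - j) s) s) = fps_nth (G * U) k"
        by (simp add: fps_mult_nth G_def U_def nstep_eq atLeast0AtMost lessThan_Suc_atMost)
      then show ?thesis using Suc by (simp add: H_def U_def age_mass_def nstep_eq del: step_pmf.simps(2))
    qed (simp add: H_def U_def age_mass_def)
  qed
  have "H = (1 - fps_X * G) * U" by (simp add: H algebra_simps)
  also have "\<dots> = D * A" by (simp add: A[symmetric] D mult_ac)
  finally have "fps_nth H k = fps_nth (D * A) k" by simp
  then show ?thesis by (simp add: H_def D_def A_def fps_mult_nth atLeast0AtMost)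
qed

text \<open>Marks remove mass only at \<open>s\<close>, where nonnegativity is the convolution
  estimate. At any other state the mass at age \<open>Suc k\<close> is a sum of masses at age
  \<open>k\<close> weighted by \<open>P\<close>.\<close>

lemma exists_nonneg_age_mass:
  assumes "aperiodic_chain P" "c > 0" "\<And>n. return_tail P s n \<le> C * exp (- c * real n)"
  shows "\<exists>m p. 0 < p \<and> p < 1 \<and> (\<forall>k x. age_mass s m p k x \<ge> 0)"
proof -
  from return_probabilities_exponential[OF assms] obtain d r L where d:
    "r > 1" "summable (\<lambda>n. \<bar>d n\<bar> * r ^ n)" "\<And>n. nstep P n s s = (\<Sum>j\<le>n. d j)"
    "(\<lambda>n. nstep P n s s) \<longlonglongrightarrow> L" "L > 0" by blast
  have "\<exists>m p. 0 < p \<and> p < 1 \<and> (\<forall>k. (\<Sum>j\<le>k. d j * gap_tail m p (k - j)) \<ge> 0)"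
    by (rule convolution_gap_tail_nonneg[OF d(3) _ d(4,5,1,2)]) (simp add: nstep_eq)
  then obtain m p where mp: "0 < p" "p < 1" and "\<And>k. (\<Sum>j\<le>k. d j * gap_tail m p (k - j)) \<ge> 0"
    by blast
  then have at_s: "age_mass s m p k s \<ge> 0" for k
    using age_mass_at_s[OF d(3)] by simp
  have "age_mass s m p k x \<ge> 0" for k x
  proof (induction k arbitrary: x)
    case (Suc k)
    show ?case
    proof (cases "x = s")
      case False
      have "0 \<le> age_mass s m p (Suc k) x + gap_prob m p k * age_mass s m p 0 x"
        by (rule has_sum_nonneg[OF age_mass_step]) (simp add: Suc P_nonneg)
      then show ?thesis using False by (simp add: age_mass_0)
    qed (use at_s in simp)
  qed (simp add: age_mass_0)
  then show ?thesis using mp by blast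
qed

end

section \<open>Sampling and independence for i.i.d. sequences\<close>

text \<open>The quantile transform, applied to \<open>\<kappa>\<close> numbered by
  \<open>to_nat\<close>. Values lie in the support for every real and not only almost surely: a
  sampler for a point mass is then constant, which later makes the state at a mark equal to
  \<open>s\<close> without exceptional sets.\<close>

lemma exists_uniform_sampler:
  fixes \<kappa> :: "'a::countable pmf"
  shows "\<exists>g. g \<in> measurable borel (count_space UNIV) \<and> (\<forall>u::real. g u \<in> set_pmf \<kappa>) \<and>
    (\<forall>y. measure (restrict_space lborel {0<..<1}) {u\<in>{0<..<1}. g u = y} = pmf \<kappa> y)"
proof -
  define M where "M = distr (measure_pmf \<kappa>) borel (\<lambda>x. real (to_nat x))"
  interpret M: real_distribution M
    unfolding M_def by (intro prob_space.real_distribution_distr measure_pmf.prob_space_axioms) simp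
  interpret M: cdf_distribution M by unfold_locales
  let ?U = "restrict_space lborel {0<..<1::real}"
  have sets_U: "sets ?U = sets (restrict_space borel {0<..<1})"
    by (simp add: sets_restrict_space)
  define h where "h u = (if u \<in> {0<..<1} then M.I u else 0)" for u
  have h[measurable]: "h \<in> borel_measurable borel"
    unfolding h_def by (rule measurable_restrict_space_iff[THEN iffD1]) auto
  obtain x0 where x0: "x0 \<in> set_pmf \<kappa>" using set_pmf_not_empty by fast
  \<comment> \<open>The default \<open>x0\<close> keeps \<open>g\<close> in the support where
    \<open>h\<close> is not the number of a support point.\<close>
  define g where "g u = (if \<exists>x\<in>set_pmf \<kappa>. h u = real (to_nat x) then from_nat (nat \<lfloor>h u\<rfloor>) else x0)" for u
  have g_eq: "g u = x" if "x \<in> set_pmf \<kappa>" "h u = real (to_nat x)" for u x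
    using that by (auto simp: g_def)
  have g_in: "g u \<in> set_pmf \<kappa>" for u
    using x0 by (auto simp: g_def)
  have g_meas: "g \<in> measurable borel (count_space UNIV)"
    unfolding g_def by measurable
  have I_law: "measure ?U {u\<in>{0<..<1}. h u = real (to_nat y)} = pmf \<kappa> y" for y
  proof -
    have "measure ?U {u\<in>{0<..<1}. h u = real (to_nat y)} = measure (distr ?U borel M.I) {real (to_nat y)}"
      by (subst measure_distr)
         (auto simp: space_restrict_space sets_U h_def intro!: arg_cong[where f="measure ?U"] cong: measurable_cong_sets)
    also have "distr ?U borel M.I = M" by (rule M.distr_I_eq_M)
    also have "measure M {real (to_nat y)} = measure (measure_pmf \<kappa>) {y}"
      unfolding M_def by (subst measure_distr) (auto intro!: arg_cong[where f="measure _"])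
    finally show ?thesis by (simp add: pmf.rep_eq)
  qed
  interpret U: prob_space ?U
    by (auto simp add: emeasure_restrict_space space_restrict_space intro!: prob_spaceI)
  have g_meas_U: "{u\<in>{0<..<1}. g u = y} \<in> sets ?U" for y
  proof -
    have "{u. g u = y} \<in> sets borel" using g_meas by measurable
    then show ?thesis by (auto simp: sets_restrict_space intro!: image_eqI[of _ _ "{u. g u = y}"])
  qed
  have h_meas_U: "{u\<in>{0<..<1}. h u = r} \<in> sets ?U" for r
  proof -
    have "{u. h u = r} \<in> sets borel" by measurable
    then show ?thesis by (auto simp: sets_restrict_space intro!: image_eqI[of _ _ "{u. h u = r}"])
  qed
  \<comment> \<open>The default can only enlarge the event for a support point, so one inequality is
    immediate. Both sides sum to 1, which forces equality.\<close>
  have ge: "pmf \<kappa> y \<le> measure ?U {u\<in>{0<..<1}. g u = y}" for y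
  proof (cases "y \<in> set_pmf \<kappa>")
    case True
    then show ?thesis
      unfolding I_law[symmetric] by (intro U.finite_measure_mono g_meas_U) (auto simp: g_eq)
  qed (simp add: set_pmf_iff)
  have law: "((\<lambda>y. measure ?U {u\<in>{0<..<1}. g u = y}) has_sum 1) UNIV"
  proof -
    have gU: "g \<in> measurable ?U (count_space UNIV)"
      using g_meas by (intro measurable_restrict_space1) simp
    interpret G: prob_space "distr ?U (count_space UNIV) g"
      by (rule U.prob_space_distr[OF gU])
    have m: "measure (distr ?U (count_space UNIV) g) {y} = measure ?U {u\<in>{0<..<1}. g u = y}" for y
      by (subst measure_distr[OF gU])
         (auto simp: space_restrict_space intro!: arg_cong[where f="measure ?U"])
    let ?D = "distr ?U (count_space UNIV) g"
    have AE: "AE x in ?D. measure ?D {x} \<noteq> 0"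
      by (subst G.AE_support_countable) auto
    have "pmf (Abs_pmf ?D) y = measure ?D {y}" for y
      by (subst pmf.rep_eq, subst Abs_pmf_inverse) (use AE G.prob_space_axioms in auto)
    then have "pmf (Abs_pmf ?D) = (\<lambda>y. measure ?U {u\<in>{0<..<1}. g u = y})"
      using m by (intro ext) simp
    then show ?thesis using has_sum_pmf[of "Abs_pmf ?D"] by simp
  qed
  have "measure ?U {u\<in>{0<..<1}. g u = y} = pmf \<kappa> y" for y
  proof (rule ccontr)
    assume "measure ?U {u\<in>{0<..<1}. g u = y} \<noteq> pmf \<kappa> y"
    then have "(1::real) < 1"
      by (intro has_sum_strict_mono[where x = y, OF has_sum_pmf[of \<kappa>] law] ge) (use ge[of y] in auto)
    then show False by simp
  qed
  then show ?thesis using g_meas g_in by blast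
qed

text \<open>A site holds one real, which must supply the bit and, independently of it, a uniform
  variable for sampling. All samplers share this variable; the law is prescribed for one
  \<open>i\<close> at a time because the recursion evaluates a single sampler per site.\<close>

lemma exists_marked_sampler:
  fixes \<kappa> :: "'i \<Rightarrow> 'a::countable pmf" and p :: real
  assumes p: "0 < p" "p < 1"
  shows "\<exists>(\<nu> :: real measure) (bit :: real \<Rightarrow> bool) samp. prob_space \<nu> \<and> sets \<nu> = sets borel \<and> Measurable.pred borel bit \<and>
    (\<forall>i. samp i \<in> measurable borel (count_space UNIV)) \<and> (\<forall>i t. samp i t \<in> set_pmf (\<kappa> i)) \<and>
    (\<forall>i b y. measure \<nu> {t. bit t = b \<and> samp i t = y} = (if b then p else 1 - p) * pmf (\<kappa> i) y)"
proof -
  have "\<forall>i. \<exists>g. g \<in> measurable borel (count_space UNIV) \<and> (\<forall>u::real. g u \<in> set_pmf (\<kappa> i)) \<and>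
    (\<forall>y. measure (restrict_space lborel {0<..<1}) {u\<in>{0<..<1}. g u = y} = pmf (\<kappa> i) y)"
    using exists_uniform_sampler by blast
  from choice[OF this] obtain g where g:
    "\<And>i. g i \<in> measurable borel (count_space UNIV)" "\<And>i u. g i (u::real) \<in> set_pmf (\<kappa> i)"
    "\<And>i y. measure (restrict_space lborel {0<..<1}) {u\<in>{0<..<1}. g i u = y} = pmf (\<kappa> i) y"
    by blast
  let ?U = "restrict_space lborel {0<..<1::real}"
  interpret U: prob_space ?U
    by (auto simp add: emeasure_restrict_space space_restrict_space intro!: prob_spaceI)
  define B where "B = measure_pmf (bernoulli_pmf p)"
  interpret B: prob_space B unfolding B_def by (rule measure_pmf.prob_space_axioms)
  interpret BU: pair_prob_space B ?U by unfold_locales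
  \<comment> \<open>The shift by 2 sends the two bits to the intervals (0,1) and (2,3), which the
    threshold 1 in \<open>bit\<close> separates.\<close>
  define code :: "bool \<times> real \<Rightarrow> real" where "code = (\<lambda>(b, u). if b then u + 2 else u)"
  define \<nu> where "\<nu> = distr (B \<Otimes>\<^sub>M ?U) borel code"
  define bit where "bit t \<longleftrightarrow> t > (1::real)" for t
  define dec where "dec t = (if bit t then t - 2 else t)" for t
  have idU[measurable]: "(\<lambda>u. u) \<in> borel_measurable ?U"
    by (intro measurable_restrict_space1) simp
  have code[measurable]: "code \<in> measurable (B \<Otimes>\<^sub>M ?U) borel"
  proof -
    have [measurable]: "fst \<in> measurable (B \<Otimes>\<^sub>M ?U) (count_space UNIV)"
      using measurable_compose[OF measurable_fst[of B ?U], of "\<lambda>b. b" "count_space UNIV"] by (simp add: B_def)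
    have [measurable]: "snd \<in> borel_measurable (B \<Otimes>\<^sub>M ?U)"
      using measurable_compose[OF measurable_snd[of B ?U] idU] by simp
    show ?thesis unfolding code_def case_prod_beta by measurable
  qed
  have bit[measurable]: "Measurable.pred borel bit" unfolding bit_def by measurable
  have dec[measurable]: "dec \<in> borel_measurable borel" unfolding dec_def by measurable
  have samp: "(\<lambda>t. g i (dec t)) \<in> measurable borel (count_space UNIV)" for i
    using measurable_compose[OF dec g(1)] .
  have "measure \<nu> {t. bit t = b \<and> g i (dec t) = y} = (if b then p else 1 - p) * pmf (\<kappa> i) y" for i b y
  proof -
    have S: "{t. bit t = b \<and> g i (dec t) = y} \<in> sets borel"
      using samp[of i] by measurable
    have D: "{u\<in>{0<..<1}. g i u = y} \<in> sets ?U"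
    proof -
      have "{u. g i u = y} \<in> sets borel" using g(1)[of i] by measurable
      then show ?thesis by (auto simp: sets_restrict_space intro!: image_eqI[of _ _ "{u. g i u = y}"])
    qed
    have "measure \<nu> {t. bit t = b \<and> g i (dec t) = y} =
        measure (B \<Otimes>\<^sub>M ?U) (code -` {t. bit t = b \<and> g i (dec t) = y} \<inter> space (B \<Otimes>\<^sub>M ?U))"
      unfolding \<nu>_def by (rule measure_distr[OF code]) (use S in simp)
    also have "code -` {t. bit t = b \<and> g i (dec t) = y} \<inter> space (B \<Otimes>\<^sub>M ?U) = {b} \<times> {u\<in>{0<..<1}. g i u = y}"
      by (auto simp: code_def bit_def dec_def space_pair_measure space_restrict_space B_def split: if_splits)
    also have "measure (B \<Otimes>\<^sub>M ?U) ({b} \<times> {u\<in>{0<..<1}. g i u = y}) = measure B {b} * measure ?U {u\<in>{0<..<1}. g i u = y}"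
      unfolding measure_def
      by (subst U.emeasure_pair_measure_Times) (use D in \<open>auto simp: B_def enn2real_mult\<close>)
    also have "measure B {b} = (if b then p else 1 - p)"
      using p by (simp add: B_def measure_pmf_single)
    finally show ?thesis by (simp only: g(3))
  qed
  moreover have "prob_space \<nu>" unfolding \<nu>_def by (rule BU.prob_space_distr[OF code])
  moreover have "sets \<nu> = sets borel" by (simp add: \<nu>_def)
  ultimately show ?thesis
    using bit samp g(2)
    by (intro exI[of _ \<nu>] exI[of _ bit] exI[of _ "\<lambda>i t. g i (dec t)"]) simp
qed

text \<open>A pointwise notion in place of measurability for a sub-sigma-algebra. It is easy to
  check for events built from marks, and a measurable event with this property is moved to the
  smaller sigma-algebra by overwriting the other coordinates with constants.\<close>

definition depends_on :: "'i set \<Rightarrow> (('i \<Rightarrow> 'b) \<Rightarrow> 'c) \<Rightarrow> bool" where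
  "depends_on I f \<longleftrightarrow> (\<forall>\<omega> \<omega>'. (\<forall>i\<in>I. \<omega> i = \<omega>' i) \<longrightarrow> f \<omega> = f \<omega>')"

lemma depends_onI:
  fixes f :: "('i \<Rightarrow> 'b) \<Rightarrow> 'c"
  assumes "\<And>\<omega> \<omega>'. (\<And>i. i \<in> I \<Longrightarrow> \<omega> i = \<omega>' i) \<Longrightarrow> f \<omega> = f \<omega>'"
  shows "depends_on I f"
  unfolding depends_on_def
proof (intro allI impI)
  fix \<omega> \<omega>' :: "'i \<Rightarrow> 'b" assume h: "\<forall>i\<in>I. \<omega> i = \<omega>' i"
  show "f \<omega> = f \<omega>'" by (rule assms) (use h in simp)
qed

lemma depends_onD:
  assumes "depends_on I f" "\<And>i. i \<in> I \<Longrightarrow> \<omega> i = \<omega>' i"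
  shows "f \<omega> = f \<omega>'"
  using assms(1)[unfolded depends_on_def, rule_format, of \<omega> \<omega>'] assms(2) by simp

abbreviation "seqs \<equiv> PiM UNIV (\<lambda>_::int. borel :: real measure)"

lemma space_seqs [simp]: "space seqs = UNIV"
  by (simp add: space_PiM)

lemma coordinate_measurable [measurable]: "(\<lambda>\<omega>. \<omega> j) \<in> measurable seqs borel"
  by (rule measurable_component_singleton) simp

lemma overwrite_measurable:
  assumes "\<And>i. i \<in> I \<Longrightarrow> (\<lambda>x. f x i) \<in> borel_measurable N"
  shows "(\<lambda>x i. if i \<in> I then f x i else c i) \<in> measurable N seqs"
proof (rule measurable_PiM_single')
  fix i :: int assume "i \<in> UNIV"
  show "(\<lambda>x. if i \<in> I then f x i else c i) \<in> borel_measurable N"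
    using assms by (cases "i \<in> I") auto
qed auto

text \<open>\<open>S\<close> is its own preimage under the map that sets all coordinates outside the
  window to 0, and this map is measurable from \<open>window_sigma r\<close>.\<close>

lemma window_measurable:
  assumes S: "S \<in> sets seqs" and dep: "depends_on {- int r..int r} (\<lambda>\<omega>. \<omega> \<in> S)"
  shows "S \<in> sets (window_sigma r)"
proof -
  have sp: "space (window_sigma r) = UNIV" by (simp add: window_sigma_def space_measure_of_conv)
  have "(\<lambda>\<omega>. \<omega> i) \<in> borel_measurable (window_sigma r)" if "i \<in> {- int r..int r}" for i
  proof (rule measurableI)
    fix B :: "real set" assume "B \<in> sets borel"
    then have "{y. y i \<in> B} \<in> sets (window_sigma r)"
      unfolding window_sigma_def using that
      by (subst sets_measure_of) (auto intro!: sigma_sets.Basic exI[of _ i] exI[of _ B])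
    then show "(\<lambda>\<omega>. \<omega> i) -` B \<inter> space (window_sigma r) \<in> sets (window_sigma r)"
      by (simp add: sp vimage_def)
  qed simp
  then have "(\<lambda>\<omega> i. if i \<in> {- int r..int r} then \<omega> i else 0) \<in> measurable (window_sigma r) seqs"
    by (rule overwrite_measurable)
  from measurable_sets[OF this S]
  have "(\<lambda>\<omega> i. if i \<in> {- int r..int r} then \<omega> i else 0) -` S \<in> sets (window_sigma r)"
    by (simp add: sp)
  also have "(\<lambda>\<omega> i. if i \<in> {- int r..int r} then \<omega> i else 0) -` S = S"
  proof -
    have "((\<lambda>i. if i \<in> {- int r..int r} then \<omega> i else 0) \<in> S) = (\<omega> \<in> S)" for \<omega>
      by (rule depends_onD[OF dep]) simp
    then show ?thesis by auto
  qed
  finally show ?thesis .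
qed

locale iid_noise = prob_space \<nu> for \<nu> :: "real measure" +
  assumes sets_nu [simp, measurable_cong]: "sets \<nu> = sets borel"
begin

abbreviation "Q \<equiv> iid_process \<nu>"

abbreviation pr :: "((int \<Rightarrow> real) \<Rightarrow> bool) \<Rightarrow> real" where
  "pr A \<equiv> measure Q {\<omega>. A \<omega>}"

lemma sets_Q [simp, measurable_cong]: "sets Q = sets seqs"
  unfolding iid_process_def by (intro sets_PiM_cong) auto

lemma space_Q [simp]: "space Q = UNIV"
  using sets_eq_imp_space_eq[OF sets_Q] by simp

lemma space_nu [simp]: "space \<nu> = UNIV"
  using sets_eq_imp_space_eq[OF sets_nu] by simp

sublocale Q: prob_space Q
  unfolding iid_process_def by (intro prob_space_PiM prob_space_axioms)

lemma ev: "Measurable.pred seqs A \<Longrightarrow> {\<omega>. A \<omega>} \<in> sets Q"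
  by (simp add: pred_def)

lemma pr_coordinate:
  assumes "Measurable.pred borel A"
  shows "pr (\<lambda>\<omega>. A (\<omega> j)) = measure \<nu> {t. A t}"
proof -
  have "distr Q \<nu> (\<lambda>\<omega>. \<omega> j) = \<nu>"
    unfolding iid_process_def by (rule distr_PiM_component) (auto intro: prob_space_axioms)
  then have "measure \<nu> {t. A t} = measure (distr Q \<nu> (\<lambda>\<omega>. \<omega> j)) {t. A t}" by simp
  also have "\<dots> = measure Q ((\<lambda>\<omega>. \<omega> j) -` {t. A t} \<inter> space Q)"
  proof (rule measure_distr)
    show "(\<lambda>\<omega>. \<omega> j) \<in> measurable Q \<nu>" by (simp cong: measurable_cong_sets)
    show "{t. A t} \<in> sets \<nu>" using assms by (simp add: pred_def)
  qed
  finally show ?thesis by (simp add: vimage_def)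
qed

lemma pr_indep:
  assumes A: "Measurable.pred seqs A" "depends_on I A"
    and B: "Measurable.pred seqs B" "depends_on J B"
    and IJ: "I \<inter> J = {}"
  shows "pr (\<lambda>\<omega>. A \<omega> \<and> B \<omega>) = pr A * pr B"
proof -
  have coord: "Q.random_variable borel (\<lambda>\<omega>. \<omega> i)" for i :: int
    by (simp cong: measurable_cong_sets)
  have id: "distr Q (PiM UNIV (\<lambda>_. borel)) (\<lambda>x. restrict x UNIV) = Q"
    using distr_id2[of seqs Q] by (simp add: restrict_def)
  have comp: "distr Q borel (\<lambda>\<omega>. \<omega> i) = \<nu>" for i
  proof -
    have "distr Q \<nu> (\<lambda>\<omega>. \<omega> i) = \<nu>"
      unfolding iid_process_def by (rule distr_PiM_component) (auto intro: prob_space_axioms)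
    moreover have "distr Q borel (\<lambda>\<omega>. \<omega> i) = distr Q \<nu> (\<lambda>\<omega>. \<omega> i)"
      by (rule distr_cong) auto
    ultimately show ?thesis by simp
  qed
  have "Q.indep_vars (\<lambda>_. borel) (\<lambda>i \<omega>. \<omega> i) (UNIV :: int set)"
    by (subst Q.indep_vars_iff_distr_eq_PiM)
       (simp_all only: coord id comp, simp_all add: iid_process_def)
  then have ind: "Q.indep_var (PiM I (\<lambda>_. borel)) (\<lambda>\<omega>. restrict (\<lambda>i. \<omega> i) I)
      (PiM J (\<lambda>_. borel)) (\<lambda>\<omega>. restrict (\<lambda>i. \<omega> i) J)"
    by (rule Q.indep_var_restrict) (use IJ in auto)
  have cut: "\<exists>S\<in>sets (PiM I (\<lambda>_. borel :: real measure)). \<forall>\<omega>. A \<omega> \<longleftrightarrow> restrict \<omega> I \<in> S"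
    if A: "Measurable.pred seqs A" "depends_on I A" for A :: "(int \<Rightarrow> real) \<Rightarrow> bool" and I
  proof -
    let ?e = "\<lambda>f i. if i \<in> I then f i else (0::real)"
    have e: "?e \<in> measurable (PiM I (\<lambda>_. borel)) seqs"
      by (rule overwrite_measurable) (rule measurable_component_singleton)
    have "Measurable.pred (PiM I (\<lambda>_. borel)) (\<lambda>f. A (?e f))"
      using measurable_compose[OF e A(1)] .
    moreover have "A (?e (restrict \<omega> I)) = A \<omega>" for \<omega>
      by (rule depends_onD[OF A(2)]) auto
    ultimately show ?thesis
      by (intro bexI[of _ "{f \<in> space (PiM I (\<lambda>_. borel)). A (?e f)}"]) (auto simp: space_PiM pred_def)
  qed
  obtain S T where S: "S \<in> sets (PiM I (\<lambda>_. borel))" "\<And>\<omega>. A \<omega> \<longleftrightarrow> restrict \<omega> I \<in> S"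
    and T: "T \<in> sets (PiM J (\<lambda>_. borel))" "\<And>\<omega>. B \<omega> \<longleftrightarrow> restrict \<omega> J \<in> T"
    using cut[OF A] cut[OF B] by blast
  from Q.indep_varD[OF ind S(1) T(1)] show ?thesis
    by (simp add: S(2) T(2) vimage_def)
qed

end

section \<open>Marks\<close>

locale marked_noise = iid_noise +
  fixes bit :: "real \<Rightarrow> bool" and p :: real and m :: nat
  assumes bit_measurable [measurable]: "Measurable.pred borel bit"
    and p: "0 < p" "p < 1"
    and bit_prob: "measure \<nu> {t. bit t} = p"
begin

definition mk :: "(int \<Rightarrow> real) \<Rightarrow> int \<Rightarrow> bool" where
  "mk \<omega> n \<longleftrightarrow> bit (\<omega> n) \<and> (\<forall>j\<in>{1..m}. \<not> bit (\<omega> (n - int j)))"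

definition has_age :: "(int \<Rightarrow> real) \<Rightarrow> int \<Rightarrow> nat \<Rightarrow> bool" where
  "has_age \<omega> n k \<longleftrightarrow> mk \<omega> (n - int k) \<and> (\<forall>j<k. \<not> mk \<omega> (n - int j))"

text \<open>A total function: without a mark at or before \<open>n\<close> its value is unspecified.
  Probabilities are therefore computed with \<open>has_age\<close>, which asserts that the mark
  exists.\<close>

definition age :: "(int \<Rightarrow> real) \<Rightarrow> int \<Rightarrow> nat" where
  "age \<omega> n = (LEAST k. mk \<omega> (n - int k))"

abbreviation "mark_prob \<equiv> p * (1 - p) ^ m"

lemma mk_measurable [measurable]: "Measurable.pred seqs (\<lambda>\<omega>. mk \<omega> n)"
  unfolding mk_def by measurable

lemma has_age_measurable [measurable]: "Measurable.pred seqs (\<lambda>\<omega>. has_age \<omega> n k)"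
  unfolding has_age_def by measurable

lemma age_measurable [measurable]: "(\<lambda>\<omega>. age \<omega> n) \<in> measurable seqs (count_space UNIV)"
  unfolding age_def by measurable

lemma has_age_imp_age: "has_age \<omega> n k \<Longrightarrow> age \<omega> n = k"
  unfolding has_age_def age_def by (intro Least_equality) (auto simp: not_less[symmetric])

lemma has_age_age: "mk \<omega> (n - int j) \<Longrightarrow> has_age \<omega> n (age \<omega> n)"
  unfolding has_age_def age_def by (auto intro: LeastI dest: not_less_Least)

lemma age_le: "mk \<omega> (n - int j) \<Longrightarrow> age \<omega> n \<le> j"
  unfolding age_def by (rule Least_le)

lemma mk_age_0: "mk \<omega> n \<Longrightarrow> age \<omega> n = 0"
  using age_le[of \<omega> n 0] by simp

lemma mk_depends: "depends_on {n - int m..n} (\<lambda>\<omega>. mk \<omega> n)"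
  by (rule depends_onI) (simp add: mk_def)

lemma mk_local:
  assumes "\<And>i. n - int m \<le> i \<Longrightarrow> i \<le> n \<Longrightarrow> \<omega> i = \<omega>' i"
  shows "mk \<omega> n = mk \<omega>' n"
  using depends_onD[OF mk_depends, of n \<omega> \<omega>'] assms by simp

lemma has_age_depends: "depends_on {..n} (\<lambda>\<omega>. has_age \<omega> n k)"
proof (rule depends_onI)
  fix \<omega> \<omega>' :: "int \<Rightarrow> real" assume "\<And>i. i \<in> {..n} \<Longrightarrow> \<omega> i = \<omega>' i"
  then have "mk \<omega> (n - int j) = mk \<omega>' (n - int j)" for j by (intro mk_local) auto
  then show "has_age \<omega> n k = has_age \<omega>' n k" by (simp add: has_age_def)
qed

text \<open>The site \<open>n\<close> carries a one but would be among the \<open>m\<close> sites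
  before \<open>n'\<close> that must carry zeros.\<close>

lemma no_close_marks: "mk \<omega> n \<Longrightarrow> n < n' \<Longrightarrow> n' \<le> n + int m \<Longrightarrow> \<not> mk \<omega> n'"
  unfolding mk_def by (auto intro!: bexI[of _ "nat (n' - n)"])

lemma pr_no_bits: "pr (\<lambda>\<omega>. \<forall>j\<in>{1..l}. \<not> bit (\<omega> (n - int j))) = (1 - p) ^ l"
proof (induction l)
  case 0
  then show ?case using Q.prob_space by simp
next
  case (Suc l)
  have bit0: "pr (\<lambda>\<omega>. \<not> bit (\<omega> j)) = 1 - p" for j
  proof -
    have "pr (\<lambda>\<omega>. \<not> bit (\<omega> j)) = measure \<nu> {t. \<not> bit t}"
      by (rule pr_coordinate) measurable
    also have "{t. \<not> bit t} = space \<nu> - {t. bit t}" by auto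
    also have "measure \<nu> \<dots> = 1 - p"
      by (subst prob_compl) (use bit_measurable in \<open>simp_all add: pred_def bit_prob\<close>)
    finally show ?thesis .
  qed
  have "pr (\<lambda>\<omega>. \<forall>j\<in>{1..Suc l}. \<not> bit (\<omega> (n - int j))) =
      pr (\<lambda>\<omega>. \<not> bit (\<omega> (n - int (Suc l))) \<and> (\<forall>j\<in>{1..l}. \<not> bit (\<omega> (n - int j))))"
  proof -
    have eq: "{1..Suc l} = insert (Suc l) {1..l}" by auto
    show ?thesis unfolding eq by (rule arg_cong[where f="measure Q"]) auto
  qed
  also have "\<dots> = pr (\<lambda>\<omega>. \<not> bit (\<omega> (n - int (Suc l)))) * pr (\<lambda>\<omega>. \<forall>j\<in>{1..l}. \<not> bit (\<omega> (n - int j)))"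
    by (rule pr_indep[where I = "{n - int (Suc l)}" and J = "{n - int l..}"])
       (auto intro!: depends_onI)
  finally show ?case by (simp only: Suc bit0 power_Suc)
qed

lemma pr_mk: "pr (\<lambda>\<omega>. mk \<omega> n) = mark_prob"
proof -
  have "pr (\<lambda>\<omega>. mk \<omega> n) = pr (\<lambda>\<omega>. bit (\<omega> n)) * pr (\<lambda>\<omega>. \<forall>j\<in>{1..m}. \<not> bit (\<omega> (n - int j)))"
    unfolding mk_def
    by (rule pr_indep[where I = "{n}" and J = "{..<n}"]) (auto intro!: depends_onI)
  then show ?thesis by (simp only: pr_no_bits pr_coordinate[OF bit_measurable] bit_prob)
qed

lemma mark_prob_pos: "0 < mark_prob" using p by simp

lemma has_age_Suc: "has_age \<omega> (n + 1) (Suc k) \<longleftrightarrow> has_age \<omega> n k \<and> \<not> mk \<omega> (n + 1)"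
  unfolding has_age_def by (auto simp: less_Suc_eq_0_disj)

text \<open>A mark at \<open>n + 1\<close> rules out marks at the last \<open>m\<close> sites up to
  \<open>n\<close>, so the age at \<open>n\<close> can be read at \<open>n - m\<close>. The age
  event then lives on sites up to \<open>n - m\<close>, disjoint from those deciding the mark; the
  resulting independence is the source of the delayed recursion of \<open>gap_tail\<close>.\<close>

lemma has_age_before_mark:
  "has_age \<omega> n k \<and> mk \<omega> (n + 1) \<longleftrightarrow> m \<le> k \<and> has_age \<omega> (n - int m) (k - m) \<and> mk \<omega> (n + 1)"
proof (cases "mk \<omega> (n + 1)")
  case True
  have none: "\<not> mk \<omega> (n - int j)" if "j < m" for j
    using no_close_marks[of \<omega> "n - int j" "n + 1"] True that by auto
  show ?thesis
  proof (cases "m \<le> k")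
    case True
    have "(\<forall>j<k. \<not> mk \<omega> (n - int j)) \<longleftrightarrow> (\<forall>j<k - m. \<not> mk \<omega> (n - int m - int j))"
    proof safe
      fix j assume "\<forall>j<k. \<not> mk \<omega> (n - int j)" "j < k - m" "mk \<omega> (n - int m - int j)"
      then show False by (auto dest!: spec[of _ "m + j"] simp: algebra_simps)
    next
      fix j assume a: "\<forall>j<k - m. \<not> mk \<omega> (n - int m - int j)" "j < k" "mk \<omega> (n - int j)"
      then have "m \<le> j" using none[of j] by (meson not_less)
      then show False using a(1)[rule_format, of "j - m"] a(2,3) by (simp add: of_nat_diff diff_less_mono)
    qed
    then show ?thesis using \<open>mk \<omega> (n + 1)\<close> True by (simp add: has_age_def of_nat_diff)
  next
    case False
    then show ?thesis using none[of k] by (auto simp: has_age_def)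
  qed
qed simp

text \<open>The hypothesis is the case \<open>k - m\<close> of \<open>pr_has_age\<close>. Stated
  this way, the lemma can be used inside the induction proving that result.\<close>

lemma pr_has_age_and_mark:
  assumes "\<And>n. pr (\<lambda>\<omega>. has_age \<omega> n (k - m)) = mark_prob * gap_tail m p (k - m)"
  shows "pr (\<lambda>\<omega>. has_age \<omega> n k \<and> mk \<omega> (n + 1)) = mark_prob * gap_prob m p k"
proof (cases "m \<le> k")
  case True
  have "pr (\<lambda>\<omega>. has_age \<omega> n k \<and> mk \<omega> (n + 1)) = pr (\<lambda>\<omega>. has_age \<omega> (n - int m) (k - m) \<and> mk \<omega> (n + 1))"
    by (subst has_age_before_mark) (simp add: True)
  also have "\<dots> = pr (\<lambda>\<omega>. has_age \<omega> (n - int m) (k - m)) * pr (\<lambda>\<omega>. mk \<omega> (n + 1))"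
    by (rule pr_indep[OF _ has_age_depends _ mk_depends]) auto
  finally show ?thesis using True assms by (simp add: pr_mk gap_prob_def)
next
  case False
  then show ?thesis by (subst has_age_before_mark) (simp add: gap_prob_def)
qed

lemma pr_has_age: "pr (\<lambda>\<omega>. has_age \<omega> n k) = mark_prob * gap_tail m p k"
proof (induction k arbitrary: n rule: less_induct)
  case (less k)
  show ?case
  proof (cases k)
    case 0
    then show ?thesis by (simp add: has_age_def pr_mk)
  next
    case (Suc l)
    have split: "pr (\<lambda>\<omega>. has_age \<omega> (n - 1) l) =
        pr (\<lambda>\<omega>. has_age \<omega> n k) + pr (\<lambda>\<omega>. has_age \<omega> (n - 1) l \<and> mk \<omega> n)"
    proof -
      have "pr (\<lambda>\<omega>. has_age \<omega> (n - 1) l) = measure Q ({\<omega>. has_age \<omega> n k} \<union> {\<omega>. has_age \<omega> (n - 1) l \<and> mk \<omega> n})"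
        using has_age_Suc[of _ "n - 1" l] Suc by (intro arg_cong[where f="measure Q"]) auto
      also have "\<dots> = pr (\<lambda>\<omega>. has_age \<omega> n k) + pr (\<lambda>\<omega>. has_age \<omega> (n - 1) l \<and> mk \<omega> n)"
        using has_age_Suc[of _ "n - 1" l] Suc by (intro Q.finite_measure_Union ev) (auto, measurable)
      finally show ?thesis .
    qed
    have "pr (\<lambda>\<omega>. has_age \<omega> (n - 1) l \<and> mk \<omega> (n - 1 + 1)) = mark_prob * gap_prob m p l"
      by (rule pr_has_age_and_mark) (rule less, use Suc in simp)
    then show ?thesis using split less[of l "n - 1"] Suc
      by (simp add: gap_tail_Suc right_diff_distrib del: gap_tail.simps)
  qed
qed

lemmas pr_has_age_mark = pr_has_age_and_mark[OF pr_has_age]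

text \<open>Sites at distance \<open>m + 1\<close> have disjoint deciding blocks, so the absence of
  marks at such sites gives independent events.\<close>

lemma pr_no_mark:
  "pr (\<lambda>\<omega>. \<forall>j<l * (m + 1). \<not> mk \<omega> (n - int j)) \<le> (1 - mark_prob) ^ l"
proof -
  have not_mk: "pr (\<lambda>\<omega>. \<not> mk \<omega> i) = 1 - mark_prob" for i
  proof -
    have "{\<omega>. \<not> mk \<omega> i} = space Q - {\<omega>. mk \<omega> i}" by auto
    then show ?thesis using Q.prob_compl[OF ev[OF mk_measurable, of i]] by (simp add: pr_mk)
  qed
  have "pr (\<lambda>\<omega>. \<forall>i<l. \<not> mk \<omega> (n - int (i * (m + 1)))) = (1 - mark_prob) ^ l"
  proof (induction l)
    case 0
    then show ?case using Q.prob_space by simp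
  next
    case (Suc l)
    have "pr (\<lambda>\<omega>. \<forall>i<Suc l. \<not> mk \<omega> (n - int (i * (m + 1)))) =
        pr (\<lambda>\<omega>. (\<forall>i<l. \<not> mk \<omega> (n - int (i * (m + 1)))) \<and> \<not> mk \<omega> (n - int (l * (m + 1))))"
      by (intro arg_cong[where f="measure Q"]) (auto simp: less_Suc_eq)
    also have "\<dots> = pr (\<lambda>\<omega>. \<forall>i<l. \<not> mk \<omega> (n - int (i * (m + 1)))) * pr (\<lambda>\<omega>. \<not> mk \<omega> (n - int (l * (m + 1))))"
    proof (rule pr_indep[where I = "{n - int (l * (m + 1)) <..}" and J = "{..n - int (l * (m + 1))}"])
      show "depends_on {n - int (l * (m + 1))<..} (\<lambda>\<omega>. \<forall>i<l. \<not> mk \<omega> (n - int (i * (m + 1))))"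
      proof (rule depends_onI)
        fix \<omega> \<omega>' :: "int \<Rightarrow> real" assume eq: "\<And>i. i \<in> {n - int (l * (m + 1))<..} \<Longrightarrow> \<omega> i = \<omega>' i"
        have "mk \<omega> (n - int (i * (m + 1))) = mk \<omega>' (n - int (i * (m + 1)))" if "i < l" for i
        proof (rule mk_local)
          fix j assume j: "n - int (i * (m + 1)) - int m \<le> j"
          have "(i + 1) * (m + 1) \<le> l * (m + 1)" using that by (intro mult_le_mono1) simp
          then have "int (i * (m + 1)) + int m < int (l * (m + 1))"
            unfolding of_nat_add[symmetric] of_nat_less_iff by simp
          then show "\<omega> j = \<omega>' j" using j by (intro eq) simp
        qed
        then show "(\<forall>i<l. \<not> mk \<omega> (n - int (i * (m + 1)))) = (\<forall>i<l. \<not> mk \<omega>' (n - int (i * (m + 1))))"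
          by simp
      qed
      show "depends_on {..n - int (l * (m + 1))} (\<lambda>\<omega>. \<not> mk \<omega> (n - int (l * (m + 1))))"
        by (rule depends_onI) (auto intro!: arg_cong[where f=Not] mk_local)
    qed auto
    finally show ?case by (simp only: Suc not_mk power_Suc2)
  qed
  moreover have "pr (\<lambda>\<omega>. \<forall>j<l * (m + 1). \<not> mk \<omega> (n - int j)) \<le> pr (\<lambda>\<omega>. \<forall>i<l. \<not> mk \<omega> (n - int (i * (m + 1))))"
  proof (rule Q.finite_measure_mono)
    show "{\<omega>. \<forall>i<l. \<not> mk \<omega> (n - int (i * (m + 1)))} \<in> sets Q" by (rule ev) measurable
    have "i * (m + 1) < l * (m + 1)" if "i < l" for i using that by (intro mult_less_mono1) auto
    then show "{\<omega>. \<forall>j<l * (m + 1). \<not> mk \<omega> (n - int j)} \<subseteq> {\<omega>. \<forall>i<l. \<not> mk \<omega> (n - int (i * (m + 1)))}"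
      by blast
  qed
  ultimately show ?thesis by simp
qed

lemma no_mark_exponential:
  "\<exists>C c. C > 0 \<and> c > 0 \<and> (\<forall>n k. pr (\<lambda>\<omega>. \<forall>j<k. \<not> mk \<omega> (n - int j)) \<le> C * exp (- c * real k))"
proof -
  define q where "q = 1 - mark_prob"
  have q: "0 < q" "q < 1"
  proof -
    have "mark_prob \<le> p * 1" using p by (intro mult_left_mono power_le_one) auto
    then have "mark_prob < 1" using p by linarith
    then show "0 < q" unfolding q_def by linarith
    show "q < 1" using mark_prob_pos by (simp add: q_def)
  qed
  \<comment> \<open>Chosen so that \<open>exp (- c * real (m + 1)) = q\<close>. The factor
    \<open>1 / q\<close> below pays for rounding \<open>k\<close> down to a multiple of
    \<open>m + 1\<close>.\<close>
  define c where "c = - ln q / real (m + 1)"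
  have c: "c > 0" using q by (simp add: c_def divide_neg_pos)
  have "pr (\<lambda>\<omega>. \<forall>j<k. \<not> mk \<omega> (n - int j)) \<le> (1 / q) * exp (- c * real k)" for n k
  proof -
    define l where "l = k div (m + 1)"
    have "pr (\<lambda>\<omega>. \<forall>j<k. \<not> mk \<omega> (n - int j)) \<le> pr (\<lambda>\<omega>. \<forall>j<l * (m + 1). \<not> mk \<omega> (n - int j))"
    proof (rule Q.finite_measure_mono)
      show "{\<omega>. \<forall>j<l * (m + 1). \<not> mk \<omega> (n - int j)} \<in> sets Q" by (rule ev) measurable
      have "l * (m + 1) \<le> k" by (simp only: l_def div_times_less_eq_dividend)
      then show "{\<omega>. \<forall>j<k. \<not> mk \<omega> (n - int j)} \<subseteq> {\<omega>. \<forall>j<l * (m + 1). \<not> mk \<omega> (n - int j)}"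
        by auto
    qed
    also have "\<dots> \<le> q ^ l" unfolding q_def by (rule pr_no_mark)
    also have "q ^ l = exp (- c * real ((m + 1) * l))"
    proof -
      have "- c * real ((m + 1) * l) = real l * ln q" unfolding c_def of_nat_mult by simp
      then show ?thesis using q by (simp add: exp_of_nat_mult)
    qed
    also have "\<dots> \<le> exp (- c * (real k - real (m + 1)))"
    proof -
      have "k < (m + 1) * l + (m + 1)"
        unfolding l_def using dividend_less_times_div[of "m + 1" k] by simp
      then have "real k - real (m + 1) \<le> real ((m + 1) * l)" by linarith
      then have "c * (real k - real (m + 1)) \<le> c * real ((m + 1) * l)" using c by (intro mult_left_mono) auto
      then show ?thesis by simp
    qed
    also have "\<dots> = exp (c * real (m + 1)) * exp (- c * real k)"
      by (simp add: algebra_simps flip: exp_add)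
    also have "exp (c * real (m + 1)) = 1 / q"
    proof -
      have "c * real (m + 1) = - ln q" unfolding c_def by simp
      then show ?thesis using q by (simp add: exp_minus field_simps)
    qed
    finally show ?thesis .
  qed
  then show ?thesis using q c by (intro exI[of _ "1 / q"] exI[of _ c]) auto
qed

text \<open>The exponential bound is uniform in \<open>n\<close>, so the right end of the interval
  may move with \<open>k\<close>; this covers intervals growing to the right.\<close>

lemma no_mark_tendsto_0: "(\<lambda>k. pr (\<lambda>\<omega>. \<forall>j<k. \<not> mk \<omega> (f k - int j))) \<longlonglongrightarrow> 0"
proof -
  obtain C c where C: "C > 0" "c > 0" "\<And>n k. pr (\<lambda>\<omega>. \<forall>j<k. \<not> mk \<omega> (n - int j)) \<le> C * exp (- c * real k)"
    using no_mark_exponential by blast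
  have "(\<lambda>k. C * exp (- c * real k)) \<longlonglongrightarrow> 0" using C(2) by real_asymp
  then show ?thesis
    by (rule tendsto_sandwich[rotated 3, where f = "\<lambda>_. 0"]) (use C(3) in auto)
qed

lemma AE_mark_before: "AE \<omega> in Q. \<exists>k. has_age \<omega> n k"
proof -
  define N where "N = {\<omega>. \<forall>j. \<not> mk \<omega> (n - int j)}"
  have N: "N \<in> sets Q" unfolding N_def by (rule ev) measurable
  have le: "measure Q N \<le> pr (\<lambda>\<omega>. \<forall>j<k. \<not> mk \<omega> (n - int j))" for k
    by (rule Q.finite_measure_mono) (auto simp: N_def simp del: sets_Q intro!: ev)
  have "measure Q N \<le> 0"
    by (rule tendsto_lowerbound[OF no_mark_tendsto_0[of "\<lambda>_. n"]]) (use le in auto)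
  then have "measure Q N = 0" by (simp add: measure_le_0_iff)
  then have "N \<in> null_sets Q" using N by (auto simp: null_sets_def Q.emeasure_eq_measure)
  then have "AE \<omega> in Q. \<omega> \<notin> N" by (rule AE_not_in)
  then show ?thesis by eventually_elim (auto simp: N_def intro: has_age_age)
qed

end

section \<open>The backward sampler\<close>

lemma has_sum_from_nn_integral:
  fixes f :: "'a \<Rightarrow> real"
  assumes "(\<integral>\<^sup>+x. ennreal (f x) \<partial>count_space UNIV) = ennreal S" "\<And>x. f x \<ge> 0" "S \<ge> 0"
  shows "(f has_sum S) UNIV"
proof -
  have int: "integrable (count_space UNIV) f"
    by (rule integrableI_nonneg) (use assms in auto)
  then have abs: "Infinite_Set_Sum.abs_summable_on f UNIV"
    by (simp add: Infinite_Set_Sum.abs_summable_on_def)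
  have "infsetsum f UNIV = S"
    unfolding infsetsum_def by (subst integral_eq_nn_integral) (use assms in auto)
  then have "infsum f UNIV = S" using abs by (simp add: infsetsum_infsum)
  then show ?thesis
    using abs by (metis abs_summable_equivalent abs_summable_summable has_sum_infsum)
qed

lemma (in finite_measure) has_sum_measure_partition:
  fixes g :: "'a \<Rightarrow> 'b::countable"
  assumes A: "A \<in> sets M" and g: "g \<in> measurable M (count_space UNIV)"
  shows "((\<lambda>y. measure M {x\<in>A. g x = y}) has_sum measure M A) UNIV"
proof (rule has_sum_from_nn_integral)
  have sets: "{x\<in>A. g x = y} \<in> sets M" for y
  proof -
    have "{x\<in>A. g x = y} = A \<inter> (g -` {y} \<inter> space M)" using sets.sets_into_space[OF A] by auto
    then show ?thesis using A measurable_sets[OF g, of "{y}"] by simp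
  qed
  have "emeasure M (\<Union>y\<in>UNIV. {x\<in>A. g x = y}) = (\<integral>\<^sup>+y. emeasure M {x\<in>A. g x = y} \<partial>count_space UNIV)"
    by (rule emeasure_UN_countable) (use sets in \<open>auto simp: disjoint_family_on_def\<close>)
  moreover have "(\<Union>y\<in>UNIV. {x\<in>A. g x = y}) = A" by auto
  ultimately show "(\<integral>\<^sup>+y. ennreal (measure M {x\<in>A. g x = y}) \<partial>count_space UNIV) = ennreal (measure M A)"
    by (simp add: emeasure_eq_measure)
qed auto

text \<open>\<open>\<kappa> k None\<close> is the law of the state given age \<open>k\<close>, and
  \<open>\<kappa> k (Some y)\<close> is Bayes' rule: the law of the state at age \<open>k\<close>
  given the next state \<open>y\<close>. By \<open>age_mass_step\<close> its normaliser is the total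
  mass arriving at \<open>y\<close>, marked and unmarked arrivals pooled.\<close>

locale backward_sampler = marked_noise \<nu> bit p m + markov_kernel P
  for \<nu> :: "real measure" and bit p m and P :: "'a::countable \<Rightarrow> 'a \<Rightarrow> real" +
  fixes s :: 'a and \<kappa> :: "nat \<Rightarrow> 'a option \<Rightarrow> 'a pmf" and samp :: "nat \<Rightarrow> 'a option \<Rightarrow> real \<Rightarrow> 'a"
  assumes samp_measurable: "\<And>k z. samp k z \<in> measurable borel (count_space UNIV)"
    and samp_law: "\<And>k z b y. measure \<nu> {t. bit t = b \<and> samp k z t = y} = (if b then p else 1 - p) * pmf (\<kappa> k z) y"
    and samp_0: "\<And>z t. samp 0 z t = s"
    and law_start: "\<And>k x. pmf (\<kappa> k None) x * gap_tail m p k = age_mass s m p k x"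
    and law_back: "\<And>k x y. pmf (\<kappa> k (Some y)) x * (age_mass s m p (Suc k) y + gap_prob m p k * age_mass s m p 0 y) =
      age_mass s m p k x * P x y"
begin

abbreviation "h \<equiv> age_mass s m p"

text \<open>The recursion starts at site \<open>n + b\<close> from the law given the age there, and
  \<open>Z \<omega> n b\<close> is its value at \<open>n\<close>.\<close>

fun Z :: "(int \<Rightarrow> real) \<Rightarrow> int \<Rightarrow> nat \<Rightarrow> 'a" where
  "Z \<omega> n 0 = samp (age \<omega> n) None (\<omega> n)"
| "Z \<omega> n (Suc b) = samp (age \<omega> n) (Some (Z \<omega> (n + 1) b)) (\<omega> n)"

text \<open>All entries use the same starting site \<open>n + b\<close>; hence \<open>b - 1\<close>
  as \<open>n\<close> advances. The truncated subtraction is faithful for lists of length at most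
  \<open>Suc b\<close>.\<close>

fun traj :: "(int \<Rightarrow> real) \<Rightarrow> int \<Rightarrow> nat \<Rightarrow> 'a list \<Rightarrow> bool" where
  "traj \<omega> n b [] = True"
| "traj \<omega> n b (x # xs) = (Z \<omega> n b = x \<and> traj \<omega> (n + 1) (b - 1) xs)"

fun path_weight :: "'a list \<Rightarrow> real" where
  "path_weight (x # y # ys) = P x y * path_weight (y # ys)"
| "path_weight _ = 1"

lemma samp_compose_measurable:
  assumes g: "g \<in> measurable seqs (count_space UNIV)"
  shows "(\<lambda>\<omega>. samp (age \<omega> n) (g \<omega>) (\<omega> n)) \<in> measurable seqs (count_space UNIV)"
proof (rule measurable_compose_countable[OF _ age_measurable])
  fix k
  show "(\<lambda>\<omega>. samp k (g \<omega>) (\<omega> n)) \<in> measurable seqs (count_space UNIV)"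
    by (rule measurable_compose_countable[OF _ g])
       (rule measurable_compose[OF coordinate_measurable samp_measurable])
qed

lemma Z_measurable [measurable]: "(\<lambda>\<omega>. Z \<omega> n b) \<in> measurable seqs (count_space UNIV)"
proof (induction b arbitrary: n)
  case (Suc b)
  have "(\<lambda>\<omega>. Some (Z \<omega> (n + 1) b)) \<in> measurable seqs (count_space UNIV)"
    using measurable_compose[OF Suc, of Some "count_space UNIV"] by simp
  then show ?case unfolding Z.simps by (rule samp_compose_measurable)
qed (simp add: samp_compose_measurable)

lemma traj_measurable [measurable]: "Measurable.pred seqs (\<lambda>\<omega>. traj \<omega> n b xs)"
  by (induction xs arbitrary: n b) simp_all

text \<open>Reals at sites of age 0 may differ, since \<open>samp 0\<close> ignores them. This
  allows the noise at a mark to be replaced.\<close>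

lemma Z_cong:
  assumes "\<And>j. n \<le> j \<Longrightarrow> age \<omega> j = age \<omega>' j \<and> (\<omega> j = \<omega>' j \<or> age \<omega> j = 0)"
  shows "Z \<omega> n b = Z \<omega>' n b"
  using assms
proof (induction b arbitrary: n)
  case 0
  then show ?case using samp_0 by (metis Z.simps(1) order_refl)
next
  case (Suc b)
  have "Z \<omega> (n + 1) b = Z \<omega>' (n + 1) b" by (rule Suc.IH, rule Suc.prems) simp
  then show ?case using Suc.prems[of n] samp_0 by (metis Z.simps(2) order_refl)
qed

lemma traj_cong:
  assumes "\<And>j. n \<le> j \<Longrightarrow> age \<omega> j = age \<omega>' j \<and> (\<omega> j = \<omega>' j \<or> age \<omega> j = 0)"
  shows "traj \<omega> n b xs = traj \<omega>' n b xs"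
  using assms
proof (induction xs arbitrary: n b)
  case (Cons x xs)
  have "traj \<omega> (n + 1) (b - 1) xs = traj \<omega>' (n + 1) (b - 1) xs" by (rule Cons.IH, rule Cons.prems) simp
  moreover have "Z \<omega> n b = Z \<omega>' n b" by (rule Z_cong) (rule Cons.prems)
  ultimately show ?case by simp
qed simp

lemma mk_bits: "(\<And>j. bit (\<omega> j) = bit (\<omega>' j)) \<Longrightarrow> mk \<omega> = mk \<omega>'"
  by (intro ext) (simp add: mk_def)

lemma ex_bit: "\<exists>t. bit t = b"
proof -
  have "measure \<nu> {t. bit t = b} > 0"
  proof (cases b)
    case False
    have "{t. bit t = b} = space \<nu> - {t. bit t}" using False by auto
    then have "measure \<nu> {t. bit t = b} = 1 - p"
      using prob_compl[of "{t. bit t}"] bit_measurable by (simp add: pred_def bit_prob)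
    then show ?thesis using p by simp
  qed (simp add: bit_prob p)
  then show ?thesis by (metis (mono_tags, lifting) Collect_empty_eq less_irrefl measure_empty)
qed

lemma pr_split_bit:
  assumes "Measurable.pred seqs A"
  shows "pr A = pr (\<lambda>\<omega>. A \<omega> \<and> bit (\<omega> n) = True) + pr (\<lambda>\<omega>. A \<omega> \<and> bit (\<omega> n) = False)"
proof -
  have [measurable]: "Measurable.pred seqs A" by fact
  have "pr A = measure Q ({\<omega>. A \<omega> \<and> bit (\<omega> n) = True} \<union> {\<omega>. A \<omega> \<and> bit (\<omega> n) = False})"
    by (intro arg_cong[where f="measure Q"]) auto
  also have "\<dots> = pr (\<lambda>\<omega>. A \<omega> \<and> bit (\<omega> n) = True) + pr (\<lambda>\<omega>. A \<omega> \<and> bit (\<omega> n) = False)"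
    by (intro Q.finite_measure_Union ev) (measurable, auto)
  finally show ?thesis .
qed

text \<open>\<open>D\<close> may involve \<open>\<omega> n\<close> through its bit, hence is not
  independent of that coordinate. For each value of the bit, \<open>\<omega> n\<close> is replaced
  inside \<open>D\<close> by a fixed real with this bit; the modified event is independent of
  coordinate \<open>n\<close>, and under \<open>\<nu>\<close> the sample is independent of the
  bit.\<close>

lemma pr_samp:
  assumes D [measurable]: "Measurable.pred seqs D"
    and bits: "\<And>\<omega> t. bit t = bit (\<omega> n) \<Longrightarrow> D (fun_upd \<omega> n t) = D \<omega>"
  shows "pr (\<lambda>\<omega>. D \<omega> \<and> samp k z (\<omega> n) = y) = pr D * pmf (\<kappa> k z) y"
proof -
  have [measurable]: "samp k z \<in> measurable borel (count_space UNIV)" by (rule samp_measurable)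
  have upd: "(\<lambda>\<omega>. fun_upd \<omega> n t) \<in> measurable seqs seqs" for t :: real
  proof -
    have "(\<lambda>\<omega> i. if i \<in> - {n} then \<omega> i else t) \<in> measurable seqs seqs"
      by (rule overwrite_measurable) simp
    also have "(\<lambda>\<omega> i. if i \<in> - {n} then \<omega> i else t) = (\<lambda>\<omega>. fun_upd \<omega> n t)" by (auto simp: fun_eq_iff)
    finally show ?thesis .
  qed
  have both: "pr (\<lambda>\<omega>. (D \<omega> \<and> samp k z (\<omega> n) = y) \<and> bit (\<omega> n) = b) = pr (\<lambda>\<omega>. D \<omega> \<and> bit (\<omega> n) = b) * pmf (\<kappa> k z) y" for b
  proof -
    obtain t where t: "bit t = b" using ex_bit by blast
    let ?D = "\<lambda>\<omega>. D (fun_upd \<omega> n t)"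
    have mD: "Measurable.pred seqs ?D" by (rule measurable_compose[OF upd D])
    have dD: "depends_on (- {n}) ?D"
      by (rule depends_onI, rule arg_cong[where f=D]) auto
    have "pr (\<lambda>\<omega>. (D \<omega> \<and> samp k z (\<omega> n) = y) \<and> bit (\<omega> n) = b) = pr (\<lambda>\<omega>. ?D \<omega> \<and> (bit (\<omega> n) = b \<and> samp k z (\<omega> n) = y))"
      using bits t by (intro arg_cong[where f="measure Q"]) auto
    also have "\<dots> = pr ?D * pr (\<lambda>\<omega>. bit (\<omega> n) = b \<and> samp k z (\<omega> n) = y)"
      by (rule pr_indep[OF mD dD, where J = "{n}"]) (measurable, auto intro!: depends_onI)
    also have "pr (\<lambda>\<omega>. bit (\<omega> n) = b \<and> samp k z (\<omega> n) = y) = (if b then p else 1 - p) * pmf (\<kappa> k z) y"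
      by (subst pr_coordinate) (measurable, rule samp_law)
    also have "(if b then p else 1 - p) = measure \<nu> {t. bit t = b}"
    proof (cases b)
      case False
      have "{t. bit t = b} = space \<nu> - {t. bit t}" using False by auto
      then show ?thesis
        using False prob_compl[of "{t. bit t}"] bit_measurable by (simp add: pred_def bit_prob)
    qed (simp add: bit_prob)
    also have "measure \<nu> {t. bit t = b} = pr (\<lambda>\<omega>. bit (\<omega> n) = b)"
      by (rule pr_coordinate[symmetric]) measurable
    also have "pr ?D * (pr (\<lambda>\<omega>. bit (\<omega> n) = b) * pmf (\<kappa> k z) y) = (pr ?D * pr (\<lambda>\<omega>. bit (\<omega> n) = b)) * pmf (\<kappa> k z) y"
      by simp
    also have "pr ?D * pr (\<lambda>\<omega>. bit (\<omega> n) = b) = pr (\<lambda>\<omega>. ?D \<omega> \<and> bit (\<omega> n) = b)"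
      by (rule pr_indep[OF mD dD, where J = "{n}", symmetric]) (measurable, auto intro!: depends_onI)
    also have "\<dots> = pr (\<lambda>\<omega>. D \<omega> \<and> bit (\<omega> n) = b)"
      using bits t by (intro arg_cong[where f="measure Q"]) auto
    finally show ?thesis .
  qed
  have "pr (\<lambda>\<omega>. D \<omega> \<and> samp k z (\<omega> n) = y) =
      pr (\<lambda>\<omega>. D \<omega> \<and> bit (\<omega> n) = True) * pmf (\<kappa> k z) y + pr (\<lambda>\<omega>. D \<omega> \<and> bit (\<omega> n) = False) * pmf (\<kappa> k z) y"
    using pr_split_bit[of "\<lambda>\<omega>. D \<omega> \<and> samp k z (\<omega> n) = y" n] unfolding both by simp
  also have "\<dots> = pr D * pmf (\<kappa> k z) y"
    using pr_split_bit[OF D, of n] by (simp only: distrib_right)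
  finally show ?thesis .
qed

text \<open>Regeneration at a mark. On \<open>mk \<omega> n\<close> the event \<open>B\<close> is
  unchanged when everything up to \<open>n\<close> is overwritten by a fixed past with a mark at
  \<open>n\<close>, and the modified event is independent of the true past.\<close>

lemma pr_renewal:
  assumes A: "Measurable.pred seqs A" "depends_on {..n} A"
    and B: "Measurable.pred seqs B"
      "\<And>\<omega> \<omega>'. mk \<omega> n \<Longrightarrow> mk \<omega>' n \<Longrightarrow> (\<And>j. n < j \<Longrightarrow> \<omega> j = \<omega>' j) \<Longrightarrow> B \<omega> = B \<omega>'"
  shows "pr (\<lambda>\<omega>. (A \<omega> \<and> mk \<omega> n) \<and> B \<omega>) * mark_prob = pr (\<lambda>\<omega>. A \<omega> \<and> mk \<omega> n) * pr (\<lambda>\<omega>. mk \<omega> n \<and> B \<omega>)"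
proof -
  have [measurable]: "Measurable.pred seqs A" by fact
  obtain t0 t1 where t: "\<not> bit t0" "bit t1" using ex_bit[of True] ex_bit[of False] by auto
  define c where "c j = (if j = n then t1 else t0)" for j
  define ov where "ov \<omega> j = (if j \<in> {n<..} then \<omega> j else c j)" for \<omega> :: "int \<Rightarrow> real" and j
  have mk_ov: "mk (ov \<omega>) n" for \<omega> using t by (auto simp: mk_def ov_def c_def)
  have ov: "ov \<in> measurable seqs seqs"
    unfolding ov_def[abs_def] by (rule overwrite_measurable) simp
  have mB: "Measurable.pred seqs (\<lambda>\<omega>. B (ov \<omega>))" by (rule measurable_compose[OF ov B(1)])
  have dB: "depends_on {n<..} (\<lambda>\<omega>. B (ov \<omega>))"
    by (rule depends_onI, rule arg_cong[where f=B]) (auto simp: ov_def)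
  have B_ov: "mk \<omega> n \<Longrightarrow> B \<omega> = B (ov \<omega>)" for \<omega>
    by (rule B(2)[OF _ mk_ov]) (auto simp: ov_def)
  have "pr (\<lambda>\<omega>. (A \<omega> \<and> mk \<omega> n) \<and> B \<omega>) = pr (\<lambda>\<omega>. (A \<omega> \<and> mk \<omega> n) \<and> B (ov \<omega>))"
    using B_ov by (intro arg_cong[where f="measure Q"]) auto
  also have "\<dots> = pr (\<lambda>\<omega>. A \<omega> \<and> mk \<omega> n) * pr (\<lambda>\<omega>. B (ov \<omega>))"
  proof (rule pr_indep[OF _ _ mB dB, where I = "{..n}"])
    show "depends_on {..n} (\<lambda>\<omega>. A \<omega> \<and> mk \<omega> n)"
    proof (rule depends_onI)
      fix \<omega> \<omega>' :: "int \<Rightarrow> real" assume e: "\<And>i. i \<in> {..n} \<Longrightarrow> \<omega> i = \<omega>' i"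
      show "(A \<omega> \<and> mk \<omega> n) = (A \<omega>' \<and> mk \<omega>' n)"
        using depends_onD[OF A(2), of \<omega> \<omega>', OF e] mk_local[of n \<omega> \<omega>'] e by auto
    qed
  qed auto
  finally have 1: "pr (\<lambda>\<omega>. (A \<omega> \<and> mk \<omega> n) \<and> B \<omega>) = pr (\<lambda>\<omega>. A \<omega> \<and> mk \<omega> n) * pr (\<lambda>\<omega>. B (ov \<omega>))" .
  have "pr (\<lambda>\<omega>. mk \<omega> n \<and> B \<omega>) = pr (\<lambda>\<omega>. mk \<omega> n \<and> B (ov \<omega>))"
    using B_ov by (intro arg_cong[where f="measure Q"]) auto
  also have "\<dots> = pr (\<lambda>\<omega>. mk \<omega> n) * pr (\<lambda>\<omega>. B (ov \<omega>))"
    by (rule pr_indep[OF _ mk_depends mB dB]) auto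
  finally show ?thesis using 1 by (simp add: pr_mk)
qed

lemma age_cong:
  assumes "\<And>i. a \<le> i \<Longrightarrow> i \<le> j \<Longrightarrow> mk \<omega> i = mk \<omega>' i" and a: "mk \<omega> a" "a \<le> j"
  shows "age \<omega> j = age \<omega>' j"
proof -
  have j: "j - int (nat (j - a)) = a" using a by simp
  have "has_age \<omega> j (age \<omega> j)" by (rule has_age_age[of _ _ "nat (j - a)"]) (simp only: j a)
  moreover have "age \<omega> j \<le> nat (j - a)" by (rule age_le) (simp only: j a)
  ultimately have "has_age \<omega>' j (age \<omega> j)"
    using assms(1) a by (auto simp: has_age_def)
  then show ?thesis by (simp add: has_age_imp_age)
qed

text \<open>The mark excludes marks at the next \<open>m\<close> sites, and any later mark is
  decided by sites beyond \<open>n\<close>. The real at \<open>n\<close> has no further influence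
  because the age there is 0.\<close>

lemma traj_after_mark:
  assumes mk: "mk \<omega> n" "mk \<omega>' n" and eq: "\<And>j. n < j \<Longrightarrow> \<omega> j = \<omega>' j"
  shows "traj \<omega> n b xs = traj \<omega>' n b xs"
proof (rule traj_cong)
  fix j assume j: "n \<le> j"
  have same: "mk \<omega> i = mk \<omega>' i" if "n \<le> i" for i
  proof (cases "i \<le> n + int m")
    case True
    then show ?thesis using mk that no_close_marks[of \<omega> n i] no_close_marks[of \<omega>' n i] by (cases "i = n") auto
  next
    case False
    then show ?thesis by (intro mk_local eq) auto
  qed
  have "age \<omega> j = age \<omega>' j"
    by (rule age_cong[of n]) (use same mk j in auto)
  moreover have "\<omega> j = \<omega>' j \<or> age \<omega> j = 0"
    using eq[of j] j mk mk_age_0[of \<omega> n] by (cases "j = n") auto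
  ultimately show "age \<omega> j = age \<omega>' j \<and> (\<omega> j = \<omega>' j \<or> age \<omega> j = 0)" by blast
qed

text \<open>The exact joint law of the age and the path. Keeping the age in the statement closes the
  induction: the next site has age \<open>Suc k\<close> or 0, the two weights add up to the
  normaliser in \<open>law_back\<close>, and that equation exchanges it for
  \<open>h k x * P x y\<close>.\<close>

lemma pr_has_age_traj:
  "length xs \<le> b \<Longrightarrow> pr (\<lambda>\<omega>. has_age \<omega> n k \<and> traj \<omega> n b (x # xs)) = mark_prob * h k x * path_weight (x # xs)"
proof (induction b arbitrary: n k x xs)
  case 0
  have "pr (\<lambda>\<omega>. has_age \<omega> n k \<and> traj \<omega> n 0 (x # xs)) = pr (\<lambda>\<omega>. has_age \<omega> n k \<and> samp k None (\<omega> n) = x)"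
    using 0 by (intro arg_cong[where f="measure Q"]) (auto dest: has_age_imp_age)
  also have "\<dots> = pr (\<lambda>\<omega>. has_age \<omega> n k) * pmf (\<kappa> k None) x"
  proof (rule pr_samp)
    fix \<omega> :: "int \<Rightarrow> real" and t assume "bit t = bit (\<omega> n)"
    then have "mk (fun_upd \<omega> n t) = mk \<omega>" by (intro mk_bits) auto
    then show "has_age (fun_upd \<omega> n t) n k = has_age \<omega> n k" by (simp add: has_age_def)
  qed measurable
  finally show ?case using 0 law_start[of k x] by (simp add: pr_has_age mult.assoc mult.commute)
next
  case (Suc b)
  have step: "pr (\<lambda>\<omega>. has_age \<omega> n k \<and> traj \<omega> n (Suc b) (x # y # ys)) = mark_prob * h k x * path_weight (x # y # ys)"
    if len: "length ys \<le> b" for y ys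
  proof -
    let ?T = "\<lambda>\<omega>. traj \<omega> (n + 1) b (y # ys)"
    let ?D = "\<lambda>\<omega>. has_age \<omega> n k \<and> ?T \<omega>"
    have "pr (\<lambda>\<omega>. has_age \<omega> n k \<and> traj \<omega> n (Suc b) (x # y # ys)) = pr (\<lambda>\<omega>. ?D \<omega> \<and> samp k (Some y) (\<omega> n) = x)"
      by (intro arg_cong[where f="measure Q"]) (auto dest: has_age_imp_age)
    also have "\<dots> = pr ?D * pmf (\<kappa> k (Some y)) x"
    proof (rule pr_samp)
      fix \<omega> :: "int \<Rightarrow> real" and t assume "bit t = bit (\<omega> n)"
      then have mk: "mk (fun_upd \<omega> n t) = mk \<omega>" by (intro mk_bits) auto
      have "?T (fun_upd \<omega> n t) = ?T \<omega>" by (rule traj_cong) (auto simp: age_def mk)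
      then show "?D (fun_upd \<omega> n t) = ?D \<omega>" by (simp add: has_age_def mk)
    qed measurable
    also have "pr ?D = pr (\<lambda>\<omega>. has_age \<omega> (n + 1) (Suc k) \<and> ?T \<omega>) + pr (\<lambda>\<omega>. (has_age \<omega> n k \<and> mk \<omega> (n + 1)) \<and> ?T \<omega>)"
    proof -
      have "pr ?D = measure Q ({\<omega>. has_age \<omega> (n + 1) (Suc k) \<and> ?T \<omega>} \<union> {\<omega>. (has_age \<omega> n k \<and> mk \<omega> (n + 1)) \<and> ?T \<omega>})"
        unfolding has_age_Suc by (intro arg_cong[where f="measure Q"]) auto
      also have "\<dots> = pr (\<lambda>\<omega>. has_age \<omega> (n + 1) (Suc k) \<and> ?T \<omega>) + pr (\<lambda>\<omega>. (has_age \<omega> n k \<and> mk \<omega> (n + 1)) \<and> ?T \<omega>)"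
        by (intro Q.finite_measure_Union ev) (measurable, auto simp: has_age_Suc)
      finally show ?thesis .
    qed
    also have "pr (\<lambda>\<omega>. has_age \<omega> (n + 1) (Suc k) \<and> ?T \<omega>) = mark_prob * h (Suc k) y * path_weight (y # ys)"
      by (rule Suc.IH[OF len])
    also have "pr (\<lambda>\<omega>. (has_age \<omega> n k \<and> mk \<omega> (n + 1)) \<and> ?T \<omega>) = mark_prob * gap_prob m p k * h 0 y * path_weight (y # ys)"
    proof -
      have "pr (\<lambda>\<omega>. (has_age \<omega> n k \<and> mk \<omega> (n + 1)) \<and> ?T \<omega>) * mark_prob =
          pr (\<lambda>\<omega>. has_age \<omega> n k \<and> mk \<omega> (n + 1)) * pr (\<lambda>\<omega>. mk \<omega> (n + 1) \<and> ?T \<omega>)"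
      proof (rule pr_renewal)
        show "depends_on {..n + 1} (\<lambda>\<omega>. has_age \<omega> n k)"
          by (rule depends_onI, rule depends_onD[OF has_age_depends]) auto
        show "?T \<omega> = ?T \<omega>'" if "mk \<omega> (n + 1)" "mk \<omega>' (n + 1)" "\<And>j. n + 1 < j \<Longrightarrow> \<omega> j = \<omega>' j" for \<omega> \<omega>'
          using that by (rule traj_after_mark)
      qed measurable
      also have "pr (\<lambda>\<omega>. mk \<omega> (n + 1) \<and> ?T \<omega>) = mark_prob * h 0 y * path_weight (y # ys)"
        using Suc.IH[OF len, of "n + 1" 0 y] by (simp add: has_age_def)
      also have "pr (\<lambda>\<omega>. has_age \<omega> n k \<and> mk \<omega> (n + 1)) = mark_prob * gap_prob m p k"
        by (rule pr_has_age_mark)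
      finally have "pr (\<lambda>\<omega>. (has_age \<omega> n k \<and> mk \<omega> (n + 1)) \<and> ?T \<omega>) * mark_prob =
          mark_prob * gap_prob m p k * h 0 y * path_weight (y # ys) * mark_prob"
        by (simp only: mult_ac)
      moreover have "mark_prob \<noteq> 0" using mark_prob_pos by (rule less_imp_neq[symmetric])
      ultimately show ?thesis by (rule mult_right_cancel[THEN iffD1, rotated])
    qed
    also have "(mark_prob * h (Suc k) y * path_weight (y # ys) + mark_prob * gap_prob m p k * h 0 y * path_weight (y # ys)) *
        pmf (\<kappa> k (Some y)) x = mark_prob * path_weight (y # ys) *
        (pmf (\<kappa> k (Some y)) x * (h (Suc k) y + gap_prob m p k * h 0 y))"
      by (simp add: algebra_simps)
    also have "\<dots> = mark_prob * h k x * path_weight (x # y # ys)"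
      unfolding law_back by simp
    finally show ?thesis .
  qed
  show ?case
  proof (cases xs)
    case (Cons y ys)
    then show ?thesis using step Suc.prems by simp
  next
    \<comment> \<open>The path has a single state, but the recursion starts further right; the
      two-state case is summed over the next state.\<close>
    case Nil
    have "((\<lambda>y. measure Q {\<omega>\<in>{\<omega>. has_age \<omega> n k \<and> traj \<omega> n (Suc b) [x]}. Z \<omega> (n + 1) b = y}) has_sum
        pr (\<lambda>\<omega>. has_age \<omega> n k \<and> traj \<omega> n (Suc b) [x])) UNIV"
    proof (rule Q.has_sum_measure_partition)
      show "{\<omega>. has_age \<omega> n k \<and> traj \<omega> n (Suc b) [x]} \<in> sets Q" by (rule ev) measurable
      show "(\<lambda>\<omega>. Z \<omega> (n + 1) b) \<in> measurable Q (count_space UNIV)"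
        using Z_measurable by (simp cong: measurable_cong_sets)
    qed
    moreover have "measure Q {\<omega>\<in>{\<omega>. has_age \<omega> n k \<and> traj \<omega> n (Suc b) [x]}. Z \<omega> (n + 1) b = y} = mark_prob * h k x * P x y" for y
      using step[of "[]" y] by (simp add: conj_ac)
    moreover have "((\<lambda>y. mark_prob * h k x * P x y) has_sum mark_prob * h k x * 1) UNIV"
      by (intro has_sum_cmult_right has_sum_P)
    ultimately show ?thesis using Nil has_sum_unique by fastforce
  qed
qed

end

section \<open>Coding function and window\<close>

context backward_sampler
begin

definition X :: "(int \<Rightarrow> real) \<Rightarrow> int \<Rightarrow> 'a" where
  "X \<omega> n = Z \<omega> n (LEAST b. mk \<omega> (n + int b))"

lemma Z_mark: "mk \<omega> n \<Longrightarrow> Z \<omega> n b = s"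
  by (cases b) (simp_all add: mk_age_0 samp_0)

text \<open>At a mark the recursion returns \<open>s\<close> whatever lies to the right, so moving
  its start beyond the mark changes nothing to the left.\<close>

lemma Z_stable: "mk \<omega> (n + int b) \<Longrightarrow> b \<le> c \<Longrightarrow> Z \<omega> n c = Z \<omega> n b"
proof (induction b arbitrary: n c)
  case (Suc b)
  then obtain c' where c: "c = Suc c'" "b \<le> c'" by (cases c) auto
  have "Z \<omega> (n + 1) c' = Z \<omega> (n + 1) b"
    using Suc.prems c by (intro Suc.IH) (simp_all add: add_ac)
  then show ?case by (simp add: c)
qed (simp add: Z_mark del: Z.simps)

lemma Z_eq_X: "mk \<omega> (n + int b) \<Longrightarrow> b \<le> c \<Longrightarrow> Z \<omega> n c = X \<omega> n"
  unfolding X_def by (rule Z_stable) (auto intro: LeastI Least_le order_trans)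

lemma X_measurable [measurable]: "(\<lambda>\<omega>. X \<omega> n) \<in> measurable seqs (count_space UNIV)"
  unfolding X_def by (rule measurable_compose_countable[OF Z_measurable]) measurable

lemma traj_iff:
  "length xs \<le> Suc b \<Longrightarrow> traj \<omega> n b xs \<longleftrightarrow> (\<forall>i<length xs. Z \<omega> (n + int i) (b - i) = xs ! i)"
proof (induction xs arbitrary: n b)
  case (Cons x xs)
  show ?case
  proof (cases b)
    case 0
    then show ?thesis using Cons.prems by simp
  next
    case (Suc c)
    then show ?thesis using Cons.IH[of c "n + 1"] Cons.prems
      by (simp add: All_less_Suc2 add_ac del: Z.simps)
  qed
qed simp

text \<open>Starting the backward recursion with the right law at a far away time changes \<open>X\<close> only if
  there is no mark in between.\<close>

lemma pr_X_eq_traj: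
  assumes L: "\<And>b. length xs \<le> b \<Longrightarrow> pr (\<lambda>\<omega>. traj \<omega> n b xs) = w"
  shows "pr (\<lambda>\<omega>. \<forall>i<length xs. X \<omega> (n + int i) = xs ! i) = w"
proof -
  let ?L = "length xs"
  let ?A = "\<lambda>\<omega>. \<forall>i<?L. X \<omega> (n + int i) = xs ! i"
  \<comment> \<open>These \<open>k\<close> sites lie to the right of the whole path and not beyond
    the start \<open>n + int (?L + k)\<close>, so one mark among them makes every \<open>Z\<close>
    on the path equal to \<open>X\<close>.\<close>
  let ?N = "\<lambda>k \<omega>. \<forall>j<k. \<not> mk \<omega> (n + int (?L + k) - int j)"
  have agree: "?A \<omega> \<longleftrightarrow> traj \<omega> n (?L + k) xs" if "\<not> ?N k \<omega>" for \<omega> k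
  proof -
    from that obtain j where j: "j < k" "mk \<omega> (n + int (?L + k) - int j)" by blast
    have "Z \<omega> (n + int i) (?L + k - i) = X \<omega> (n + int i)" if "i < ?L" for i
    proof (rule Z_eq_X)
      show "?L + k - j - i \<le> ?L + k - i" by simp
      have "n + int i + int (?L + k - j - i) = n + int (?L + k) - int j" using that j by simp
      then show "mk \<omega> (n + int i + int (?L + k - j - i))" using j(2) by (simp only:)
    qed
    then show ?thesis by (simp add: traj_iff)
  qed
  have bound: "\<bar>pr ?A - w\<bar> \<le> pr (?N k)" for k
  proof -
    have m1: "{\<omega>. ?A \<omega>} \<in> sets Q" by (rule ev) measurable
    have m2: "{\<omega>. traj \<omega> n (?L + k) xs} \<in> sets Q" by (rule ev) measurable
    have m3: "{\<omega>. ?N k \<omega>} \<in> sets Q" by (rule ev) measurable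
    note m = m1 m2 m3
    have "pr ?A \<le> measure Q ({\<omega>. traj \<omega> n (?L + k) xs} \<union> {\<omega>. ?N k \<omega>})"
      using agree m by (intro Q.finite_measure_mono) (auto simp del: sets_Q)
    also have "\<dots> \<le> w + pr (?N k)"
      using L[of "?L + k"] measure_Un_le[OF m2 m3] by simp
    finally have 1: "pr ?A \<le> w + pr (?N k)" .
    have "w = pr (\<lambda>\<omega>. traj \<omega> n (?L + k) xs)" using L[of "?L + k"] by simp
    also have "\<dots> \<le> measure Q ({\<omega>. ?A \<omega>} \<union> {\<omega>. ?N k \<omega>})"
      using agree m by (intro Q.finite_measure_mono) (auto simp del: sets_Q)
    also have "\<dots> \<le> pr ?A + pr (?N k)"
      by (rule measure_Un_le[OF m1 m3])
    finally show ?thesis using 1 by linarith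
  qed
  have "(\<lambda>k. pr (?N k)) \<longlonglongrightarrow> 0"
    using no_mark_tendsto_0[of "\<lambda>k. n + int (?L + k)"] .
  then have "\<bar>pr ?A - w\<bar> \<le> 0"
    by (rule tendsto_lowerbound) (use bound in auto)
  then show ?thesis by simp
qed

lemma has_sum_traj:
  assumes "length xs \<le> b"
  shows "((\<lambda>k. mark_prob * h k x * path_weight (x # xs)) has_sum pr (\<lambda>\<omega>. traj \<omega> n b (x # xs))) UNIV"
proof -
  let ?T = "\<lambda>\<omega>. traj \<omega> n b (x # xs)"
  have T: "{\<omega>. ?T \<omega>} \<in> sets Q" by (rule ev) measurable
  have "((\<lambda>k. measure Q {\<omega>\<in>{\<omega>. ?T \<omega>}. age \<omega> n = k}) has_sum pr ?T) UNIV"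
  proof (rule Q.has_sum_measure_partition[OF T])
    show "(\<lambda>\<omega>. age \<omega> n) \<in> measurable Q (count_space UNIV)"
      using age_measurable by (simp cong: measurable_cong_sets)
  qed
  moreover have "measure Q {\<omega>\<in>{\<omega>. ?T \<omega>}. age \<omega> n = k} = mark_prob * h k x * path_weight (x # xs)" for k
  proof -
    have "measure Q {\<omega>\<in>{\<omega>. ?T \<omega>}. age \<omega> n = k} = pr (\<lambda>\<omega>. has_age \<omega> n k \<and> ?T \<omega>)"
    proof (rule Q.finite_measure_eq_AE)
      show "AE \<omega> in Q. (\<omega> \<in> {\<omega> \<in> {\<omega>. ?T \<omega>}. age \<omega> n = k}) = (\<omega> \<in> {\<omega>. has_age \<omega> n k \<and> ?T \<omega>})"
        using AE_mark_before[of n] by eventually_elim (auto dest: has_age_imp_age)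
      have "{\<omega>. ?T \<omega> \<and> age \<omega> n = k} \<in> sets Q" by (rule ev) measurable
      then show "{\<omega> \<in> {\<omega>. ?T \<omega>}. age \<omega> n = k} \<in> sets Q" by (simp del: sets_Q)
      show "{\<omega>. has_age \<omega> n k \<and> ?T \<omega>} \<in> sets Q" by (rule ev) measurable
    qed
    then show ?thesis using pr_has_age_traj[OF assms] by simp
  qed
  ultimately show ?thesis by simp
qed

text \<open>By \<open>has_sum_init_law\<close> this is the cycle formula for a stationary law: the
  expected number of visits to \<open>x\<close> between marks times the frequency of marks.\<close>

definition init_law :: "'a \<Rightarrow> real" where
  "init_law x = pr (\<lambda>\<omega>. traj \<omega> 0 0 [x])"

lemma has_sum_init_law: "((\<lambda>k. mark_prob * h k x) has_sum init_law x) UNIV"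
  unfolding init_law_def using has_sum_traj[of "[]" 0 x 0] by simp

lemma pr_traj: "length xs \<le> b \<Longrightarrow> pr (\<lambda>\<omega>. traj \<omega> n b (x # xs)) = init_law x * path_weight (x # xs)"
  using has_sum_unique[OF has_sum_traj has_sum_cmult_left[OF has_sum_init_law]] by blast

definition init_pmf :: "'a pmf" where
  "init_pmf = embed_pmf init_law"

lemma pmf_init: "pmf init_pmf x = init_law x"
proof -
  have "((\<lambda>x. measure Q {\<omega>\<in>{\<omega>. True}. Z \<omega> 0 0 = x}) has_sum measure Q {\<omega>. True}) UNIV"
  proof (rule Q.has_sum_measure_partition)
    show "{\<omega>. True} \<in> sets Q" by (rule ev) measurable
    show "(\<lambda>\<omega>. Z \<omega> 0 0) \<in> measurable Q (count_space UNIV)"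
      using Z_measurable[of 0 0] by (simp cong: measurable_cong_sets del: Z.simps)
  qed
  moreover have "measure Q {\<omega>\<in>{\<omega>. True}. Z \<omega> 0 0 = x} = init_law x" for x
    by (simp add: init_law_def)
  moreover have "measure Q {\<omega>. True} = 1" using Q.prob_space by simp
  ultimately have "(init_law has_sum 1) UNIV" by simp
  then show ?thesis unfolding init_pmf_def
    by (rule embed_pmf_has_sum) (simp add: init_law_def)
qed

text \<open>The two-state path law, with the recursion started at site 1, is summed over the state
  at site 0.\<close>

lemma init_stationary: "bind_pmf init_pmf K = init_pmf"
proof (rule pmf_eqI)
  fix x
  have "((\<lambda>y. measure Q {\<omega>\<in>{\<omega>. traj \<omega> 1 0 [x]}. Z \<omega> 0 1 = y}) has_sum pr (\<lambda>\<omega>. traj \<omega> 1 0 [x])) UNIV"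
  proof (rule Q.has_sum_measure_partition)
    show "{\<omega>. traj \<omega> 1 0 [x]} \<in> sets Q" by (rule ev) measurable
    show "(\<lambda>\<omega>. Z \<omega> 0 1) \<in> measurable Q (count_space UNIV)"
      using Z_measurable[of 0 1] by (simp cong: measurable_cong_sets)
  qed
  moreover have "measure Q {\<omega>\<in>{\<omega>. traj \<omega> 1 0 [x]}. Z \<omega> 0 1 = y} = init_law y * P y x" for y
    using pr_traj[of "[x]" 1 0 y] by (simp add: conj_ac)
  moreover have "pr (\<lambda>\<omega>. traj \<omega> 1 0 [x]) = init_law x" using pr_traj[of "[]" 0 1 x] by simp
  ultimately have "((\<lambda>y. pmf init_pmf y * pmf (K y) x) has_sum pmf init_pmf x) UNIV"
    by (simp add: pmf_init)
  with pmf_bind_has_sum show "pmf (bind_pmf init_pmf K) x = pmf init_pmf x"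
    by (rule has_sum_unique)
qed

lemma pr_X:
  assumes "xs \<noteq> []"
  shows "pr (\<lambda>\<omega>. \<forall>i<length xs. X \<omega> (n + int i) = xs ! i) = pmf init_pmf (hd xs) * path_weight xs"
proof (rule pr_X_eq_traj)
  fix b assume "length xs \<le> b"
  then show "pr (\<lambda>\<omega>. traj \<omega> n b xs) = pmf init_pmf (hd xs) * path_weight xs"
    using assms by (cases xs) (simp_all add: pmf_init pr_traj del: traj.simps)
qed

lemma path_weight_prod: "xs \<noteq> [] \<Longrightarrow> path_weight xs = (\<Prod>i<length xs - 1. P (xs ! i) (xs ! Suc i))"
proof (induction xs rule: path_weight.induct)
  case (1 x y ys)
  then show ?case by (simp add: prod.lessThan_Suc_shift del: prod.lessThan_Suc)
qed simp_all

section \<open>Shift equivariance and the coding window\<close>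

definition code :: "(int \<Rightarrow> real) \<Rightarrow> 'a" where
  "code \<omega> = X \<omega> 0"

lemma X_shift: "X (shift_seq n \<omega>) j = X \<omega> (j + n)"
proof -
  have mk: "mk (shift_seq n \<omega>) i = mk \<omega> (i + n)" for i
    by (simp add: mk_def shift_seq_def algebra_simps)
  have age: "age (shift_seq n \<omega>) i = age \<omega> (i + n)" for i
    by (simp add: age_def mk algebra_simps)
  have Z: "Z (shift_seq n \<omega>) i b = Z \<omega> (i + n) b" for i b
  proof (induction b arbitrary: i)
    case 0
    show ?case unfolding Z.simps age by (simp add: shift_seq_def)
  next
    case (Suc b)
    have "i + 1 + n = i + n + 1" by simp
    then show ?case unfolding Z.simps age Suc by (simp only: shift_seq_def)
  qed
  show ?thesis by (simp add: X_def Z mk algebra_simps)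
qed

lemma code_shift: "code (shift_seq n \<omega>) = X \<omega> n"
  by (simp add: code_def X_shift)

text \<open>A mark at \<open>- int j\<close> is decided by the sites from
  \<open>- int j - int m\<close> on, so keeping them inside the window requires
  \<open>j \<le> r - m\<close>. The guard \<open>m \<le> r\<close> keeps the subtraction from
  truncating.\<close>

definition window_ok :: "nat \<Rightarrow> (int \<Rightarrow> real) \<Rightarrow> bool" where
  "window_ok r \<omega> \<longleftrightarrow> m \<le> r \<and> (\<exists>j\<le>r - m. mk \<omega> (- int j)) \<and> (\<exists>j\<le>r. mk \<omega> (int j))"

definition window :: "(int \<Rightarrow> real) \<Rightarrow> enat" where
  "window \<omega> = (INF r\<in>{r. window_ok r \<omega>}. enat r)"

lemma window_ok_mono: "window_ok r \<omega> \<Longrightarrow> r \<le> r' \<Longrightarrow> window_ok r' \<omega>"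
  unfolding window_ok_def by (meson diff_le_mono order_trans)

lemma window_le_iff: "window \<omega> \<le> enat r \<longleftrightarrow> window_ok r \<omega>"
proof
  assume le: "window \<omega> \<le> enat r"
  have ne: "enat ` {r. window_ok r \<omega>} \<noteq> {}"
  proof
    assume "enat ` {r. window_ok r \<omega>} = {}"
    then have "window \<omega> = \<infinity>" by (simp only: window_def Inf_enat_def if_True simp_thms)
    with le show False by simp
  qed
  then have "window \<omega> \<in> enat ` {r. window_ok r \<omega>}"
    unfolding window_def by (simp only: Inf_enat_def if_False) (rule LeastI_ex, blast)
  then obtain q where "window \<omega> = enat q" "window_ok q \<omega>" by auto
  with le show "window_ok r \<omega>" using window_ok_mono by auto
next
  assume "window_ok r \<omega>"
  then show "window \<omega> \<le> enat r" unfolding window_def by (intro INF_lower) simp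
qed

lemma window_ok_measurable [measurable]: "Measurable.pred seqs (window_ok r)"
  unfolding window_ok_def[abs_def] by measurable

text \<open>The mark on the left determines all ages from the origin to \<open>r\<close>, and the
  mark on the right starts the backward recursion. Every real consulted lies inside the
  window.\<close>

lemma window_local:
  assumes eq: "\<And>i. i \<in> {- int r..int r} \<Longrightarrow> \<omega> i = \<omega>' i" and ok: "window_ok r \<omega>"
  shows "window_ok r \<omega>'" "code \<omega> = code \<omega>'"
proof -
  from ok obtain a b where r: "m \<le> r" and a: "a \<le> r - m" "mk \<omega> (- int a)" and b: "b \<le> r" "mk \<omega> (int b)"
    unfolding window_ok_def by blast
  have same: "mk \<omega> i = mk \<omega>' i" if "- int a \<le> i" "i \<le> int r" for i
    using that a(1) r by (intro mk_local eq) auto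
  have a': "mk \<omega>' (- int a)" and b': "mk \<omega>' (int b)" using same[of "- int a"] same[of "int b"] a b by auto
  then show "window_ok r \<omega>'" unfolding window_ok_def using r a b by blast
  have age: "age \<omega> i = age \<omega>' i" if "0 \<le> i" "i \<le> int r" for i
    by (rule age_cong[of "- int a"]) (use same a that in auto)
  have Z: "Z \<omega> i c = Z \<omega>' i c" if "0 \<le> i" "i + int c \<le> int r" for i c
    using that
  proof (induction c arbitrary: i)
    case 0
    then show ?case using age[of i] eq[of i] by simp
  next
    case (Suc c)
    then show ?case using age[of i] eq[of i] Suc.IH[of "i + 1"] by simp
  qed
  have "code \<omega> = Z \<omega> 0 b" using Z_eq_X[of \<omega> 0 b b] b by (simp add: code_def)
  also have "\<dots> = Z \<omega>' 0 b" using b by (intro Z) auto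
  also have "\<dots> = code \<omega>'" using Z_eq_X[of \<omega>' 0 b b] b' by (simp add: code_def)
  finally show "code \<omega> = code \<omega>'" .
qed

lemma code_measurable: "code \<in> measurable seqs (count_space UNIV)"
  unfolding code_def[abs_def] by measurable

lemma window_sets:
  "{\<omega>. window \<omega> \<le> enat r} \<in> sets (window_sigma r)"
  "code -` A \<inter> {\<omega>. window \<omega> \<le> enat r} \<in> sets (window_sigma r)"
proof -
  have ok: "window_ok r \<omega> = window_ok r \<omega>'" if "\<And>i. i \<in> {- int r..int r} \<Longrightarrow> \<omega> i = \<omega>' i" for \<omega> \<omega>'
    using window_local(1)[of r \<omega> \<omega>'] window_local(1)[of r \<omega>' \<omega>] that by fastforce
  have m: "{\<omega>. window_ok r \<omega>} \<in> sets seqs"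
    using window_ok_measurable by (simp add: pred_def)
  show "{\<omega>. window \<omega> \<le> enat r} \<in> sets (window_sigma r)"
    unfolding window_le_iff
  proof (rule window_measurable[OF m], rule depends_onI)
    fix \<omega> \<omega>' :: "int \<Rightarrow> real" assume "\<And>i. i \<in> {- int r..int r} \<Longrightarrow> \<omega> i = \<omega>' i"
    then show "(\<omega> \<in> {\<omega>. window_ok r \<omega>}) = (\<omega>' \<in> {\<omega>. window_ok r \<omega>})"
      using ok[of \<omega> \<omega>'] by simp
  qed
  show "code -` A \<inter> {\<omega>. window \<omega> \<le> enat r} \<in> sets (window_sigma r)"
    unfolding window_le_iff
  proof (rule window_measurable)
    show "code -` A \<inter> {\<omega>. window_ok r \<omega>} \<in> sets seqs"
      using measurable_sets[OF code_measurable, of A] m by simp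
    show "depends_on {- int r..int r} (\<lambda>\<omega>. \<omega> \<in> code -` A \<inter> {\<omega>. window_ok r \<omega>})"
    proof (rule depends_onI)
      fix \<omega> \<omega>' :: "int \<Rightarrow> real" assume e: "\<And>i. i \<in> {- int r..int r} \<Longrightarrow> \<omega> i = \<omega>' i"
      show "(\<omega> \<in> code -` A \<inter> {\<omega>. window_ok r \<omega>}) = (\<omega>' \<in> code -` A \<inter> {\<omega>. window_ok r \<omega>})"
        using ok[OF e] window_local(2)[OF e] by auto
    qed
  qed
qed

lemma window_tails: "exponential_tails \<nu> window"
proof -
  obtain C c where C: "C > 0" "c > 0" "\<And>n k. pr (\<lambda>\<omega>. \<forall>j<k. \<not> mk \<omega> (n - int j)) \<le> C * exp (- c * real k)"
    using no_mark_exponential by blast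
  \<comment> \<open>The exponential factor absorbs the shift of \<open>r\<close> by
    \<open>m + 1\<close>, the term \<open>2 * C\<close> serves the two directions, and the summand 1
    makes the bound trivial for \<open>r \<le> m\<close>.\<close>
  define D where "D = (2 * C + 1) * exp (c * real (m + 1))"
  have "measure Q {\<omega>. window \<omega> \<ge> enat r} \<le> D * exp (- c * real r)" if r: "r \<ge> 1" for r
  proof -
    have ge: "window \<omega> \<ge> enat r \<longleftrightarrow> \<not> window_ok (r - 1) \<omega>" for \<omega>
    proof -
      have "window \<omega> \<ge> enat r \<longleftrightarrow> \<not> window \<omega> \<le> enat (r - 1)"
        using r by (cases "window \<omega>") auto
      then show ?thesis by (simp only: window_le_iff)
    qed
    have D_eq: "D * exp (- c * real r) = (2 * C + 1) * exp (- c * (real r - real (m + 1)))"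
      by (simp add: D_def algebra_simps flip: exp_add)
    show ?thesis
    proof (cases "m \<le> r - 1")
      case False
      then have "real r - real (m + 1) \<le> 0" by simp
      then have "exp (- c * (real r - real (m + 1))) \<ge> 1"
        using C(2) by (simp add: mult_nonneg_nonpos)
      then have "1 \<le> (2 * C + 1) * exp (- c * (real r - real (m + 1)))"
        using C(1) mult_mono[of 1 "2 * C + 1" 1 "exp (- c * (real r - real (m + 1)))"] by simp
      then show ?thesis unfolding D_eq using Q.prob_le_1 order_trans by blast
    next
      case True
      define k where "k = r - m"
      have k: "real k = real r - real m" "k \<ge> 1" "r - 1 - m = k - 1" using True r by (auto simp: k_def)
      have m1: "{\<omega>. \<forall>j<k. \<not> mk \<omega> (0 - int j)} \<in> sets Q" by (rule ev) measurable
      have m2: "{\<omega>. \<forall>j<r. \<not> mk \<omega> (int (r - 1) - int j)} \<in> sets Q" by (rule ev) measurable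
      note m = m1 m2
      have "{\<omega>. window \<omega> \<ge> enat r} \<subseteq> {\<omega>. \<forall>j<k. \<not> mk \<omega> (0 - int j)} \<union> {\<omega>. \<forall>j<r. \<not> mk \<omega> (int (r - 1) - int j)}"
      proof
        fix \<omega> assume "\<omega> \<in> {\<omega>. window \<omega> \<ge> enat r}"
        then have "\<not> window_ok (r - 1) \<omega>" by (simp add: ge)
        then consider "\<forall>j\<le>k - 1. \<not> mk \<omega> (- int j)" | "\<forall>j\<le>r - 1. \<not> mk \<omega> (int j)"
          using True k by (auto simp: window_ok_def)
        then show "\<omega> \<in> {\<omega>. \<forall>j<k. \<not> mk \<omega> (0 - int j)} \<union> {\<omega>. \<forall>j<r. \<not> mk \<omega> (int (r - 1) - int j)}"
        proof cases
          case 1 then show ?thesis using k(2) by auto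
        next
          case 2
          have "\<not> mk \<omega> (int (r - 1) - int j)" if "j < r" for j
          proof -
            have "int (r - 1 - j) = int (r - 1) - int j" using that by (intro of_nat_diff) simp
            then show ?thesis using 2[rule_format, OF diff_le_self[of "r - 1" j]] by (simp only: not_False_eq_True)
          qed
          then show ?thesis by blast
        qed
      qed
      then have "measure Q {\<omega>. window \<omega> \<ge> enat r} \<le>
          measure Q ({\<omega>. \<forall>j<k. \<not> mk \<omega> (0 - int j)} \<union> {\<omega>. \<forall>j<r. \<not> mk \<omega> (int (r - 1) - int j)})"
        by (rule Q.finite_measure_mono) (rule sets.Un[OF m])
      also have "\<dots> \<le> pr (\<lambda>\<omega>. \<forall>j<k. \<not> mk \<omega> (0 - int j)) + pr (\<lambda>\<omega>. \<forall>j<r. \<not> mk \<omega> (int (r - 1) - int j))"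
        by (rule measure_Un_le[OF m])
      also have "\<dots> \<le> C * exp (- c * real k) + C * exp (- c * real r)"
        by (intro add_mono C(3))
      also have "\<dots> \<le> C * exp (- c * (real r - real (m + 1))) + C * exp (- c * (real r - real (m + 1)))"
        using C k(1) by (intro add_mono mult_left_mono) (auto simp: mult_left_mono)
      also have "\<dots> \<le> (2 * C + 1) * exp (- c * (real r - real (m + 1)))"
        by (simp add: distrib_right)
      finally show ?thesis unfolding D_eq .
    qed
  qed
  moreover have "D > 0" using C(1) by (simp add: D_def)
  ultimately show ?thesis unfolding exponential_tails_def using C(2) by blast
qed

lemma window_finite: "AE \<omega> in Q. window \<omega> \<noteq> \<infinity>"
proof -
  obtain C c where C: "c > 0" "\<And>r. r \<ge> 1 \<Longrightarrow> measure Q {\<omega>. window \<omega> \<ge> enat r} \<le> C * exp (- c * real r)"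
    using window_tails unfolding exponential_tails_def by blast
  define N where "N = {\<omega>. \<forall>r. \<not> window_ok r \<omega>}"
  have N: "N \<in> sets Q" unfolding N_def by (rule ev) measurable
  have N_eq: "\<omega> \<in> N \<longleftrightarrow> window \<omega> = \<infinity>" for \<omega>
    unfolding N_def by (cases "window \<omega>") (auto simp flip: window_le_iff)
  have "measure Q N \<le> C * exp (- c * real r)" if "r \<ge> 1" for r
  proof -
    have "{\<omega>. window \<omega> \<ge> enat r} = {\<omega>. \<not> window_ok (r - 1) \<omega>}"
    proof -
      have "window \<omega> \<ge> enat r \<longleftrightarrow> \<not> window \<omega> \<le> enat (r - 1)" for \<omega>
        using that by (cases "window \<omega>") auto
      then show ?thesis by (simp only: window_le_iff)
    qed
    moreover have "{\<omega>. \<not> window_ok (r - 1) \<omega>} \<in> sets Q" by (rule ev) measurable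
    ultimately have "{\<omega>. window \<omega> \<ge> enat r} \<in> sets Q" by (simp only:)
    then have "measure Q N \<le> measure Q {\<omega>. window \<omega> \<ge> enat r}"
      by (intro Q.finite_measure_mono) (auto simp: N_eq)
    then show ?thesis using C(2)[OF that] by linarith
  qed
  moreover have "(\<lambda>r. C * exp (- c * real r)) \<longlonglongrightarrow> 0" using C(1) by real_asymp
  ultimately have "measure Q N \<le> 0"
    by (intro tendsto_lowerbound[of "\<lambda>r. C * exp (- c * real r)" 0 sequentially])
       (auto simp: eventually_sequentially intro!: exI[of _ 1])
  then have "N \<in> null_sets Q" using N by (auto simp: null_sets_def Q.emeasure_eq_measure measure_le_0_iff)
  then have "AE \<omega> in Q. \<omega> \<notin> N" by (rule AE_not_in)
  then show ?thesis by (rule eventually_mono) (simp only: N_eq not_False_eq_True)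
qed

lemma coding: "coding_window \<nu> code window"
  unfolding coding_window_def
proof (intro conjI allI)
  show "{\<omega>. window \<omega> \<le> enat r} \<in> sets (window_sigma r)" for r by (rule window_sets)
  show "AE \<omega> in Q. window \<omega> \<noteq> \<infinity>" by (rule window_finite)
  show "code \<in> measurable seqs (count_space UNIV)" by (rule code_measurable)
  show "code -` A \<inter> {\<omega>. window \<omega> \<le> enat r} \<in> sets (window_sigma r)" for A r by (rule window_sets)
qed

end

section \<open>Equality of laws\<close>

text \<open>Every finite index set lies in some interval from \<open>- r\<close> to
  \<open>r\<close>, so blocks of consecutive sites suffice. As lists over a countable type are
  countable, the law of a block is determined by its atoms.\<close>

lemma process_law_eqI:
  fixes M N :: "(int \<Rightarrow> 'a::countable) measure"
  assumes M: "prob_space M" "sets M = sets (PiM UNIV (\<lambda>_. count_space UNIV))"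
    and N: "prob_space N" "sets N = sets (PiM UNIV (\<lambda>_. count_space UNIV))"
    and eq: "\<And>n xs. xs \<noteq> [] \<Longrightarrow> measure M {f. \<forall>i<length xs. f (n + int i) = xs ! i} =
      measure N {f. \<forall>i<length xs. f (n + int i) = xs ! i}"
  shows "M = N"
proof (rule measure_eqI_PiM_infinite[OF M(2) N(2)])
  interpret M: prob_space M by fact
  interpret N: prob_space N by fact
  show "finite_measure M" by unfold_locales
  let ?S = "PiM UNIV (\<lambda>_::int. count_space (UNIV :: 'a set))"
  fix A :: "int \<Rightarrow> 'a set" and J :: "int set" assume J: "finite J"
  obtain r :: nat where r: "\<And>j. j \<in> J \<Longrightarrow> \<bar>j\<bar> \<le> int r"
  proof -
    have "j \<in> J \<Longrightarrow> \<bar>j\<bar> \<le> int (nat (\<Sum>j\<in>J. \<bar>j\<bar>))" for j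
      using member_le_sum[of j J abs] J by simp
    then show ?thesis using that by blast
  qed
  define l where "l = 2 * r + 1"
  define T :: "(int \<Rightarrow> 'a) \<Rightarrow> 'a list" where "T f = map (\<lambda>i. f (- int r + int i)) [0..<l]" for f
  have len: "length (T f) = l" and nth: "i < l \<Longrightarrow> T f ! i = f (- int r + int i)" for f i
    by (simp_all add: T_def)
  have T_eq: "T f = xs \<longleftrightarrow> length xs = l \<and> (\<forall>i<length xs. f (- int r + int i) = xs ! i)" for f xs
    unfolding list_eq_iff_nth_eq using len[of f] nth[of _ f] by (metis (no_types, lifting))
  have fibre: "T -` {xs} = (if length xs = l then {f. \<forall>i<length xs. f (- int r + int i) = xs ! i} else {})" for xs
    by (simp add: vimage_def T_eq)
  have path_set: "{f. \<forall>i<length xs. f (- int r + int i) = xs ! i} \<in> sets ?S" for xs :: "'a list"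
  proof -
    have "{f \<in> space ?S. \<forall>i<length xs. f (- int r + int i) = xs ! i} \<in> sets ?S"
      by measurable
    then show ?thesis by (simp add: space_PiM)
  qed
  have "T -` {xs} \<in> sets ?S" for xs
  proof (cases "length xs = l")
    case True
    show ?thesis unfolding fibre if_P[OF True] by (rule path_set)
  next
    case False
    show ?thesis unfolding fibre if_not_P[OF False] by simp
  qed
  then have T: "T \<in> measurable ?S (count_space UNIV)"
    by (subst measurable_count_space_eq_countable) (auto simp: space_PiM)
  have T_M: "T \<in> measurable M (count_space UNIV)" and T_N: "T \<in> measurable N (count_space UNIV)"
    using T M(2) N(2) by (simp_all cong: measurable_cong_sets)
  have sp: "space M = UNIV" "space N = UNIV"
    using sets_eq_imp_space_eq[OF M(2)] sets_eq_imp_space_eq[OF N(2)] by (simp_all add: space_PiM)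
  have same: "distr M (count_space UNIV) T = distr N (count_space UNIV) T"
  proof (rule measure_eqI_countable[of _ UNIV])
    fix xs
    have "measure M (T -` {xs}) = measure N (T -` {xs})"
    proof (cases "length xs = l")
      case True
      then have "xs \<noteq> []" by (auto simp: l_def)
      then show ?thesis unfolding fibre if_P[OF True] by (rule eq)
    next
      case False
      show ?thesis unfolding fibre if_not_P[OF False] by simp
    qed
    then show "emeasure (distr M (count_space UNIV) T) {xs} = emeasure (distr N (count_space UNIV) T) {xs}"
      by (simp add: emeasure_distr[OF T_M] emeasure_distr[OF T_N] sp M.emeasure_eq_measure N.emeasure_eq_measure)
  qed auto
  define B where "B = {xs. \<forall>j\<in>J. xs ! nat (j + int r) \<in> A j}"
  have emb: "prod_emb UNIV (\<lambda>_. count_space UNIV) J (Pi\<^sub>E J A) = T -` B"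
  proof -
    have "T f ! nat (j + int r) = f j" if "j \<in> J" for f j
    proof -
      have "j + int r \<ge> 0" "j + int r < int l" using r[OF that] by (auto simp: l_def)
      then show ?thesis using nth[of "nat (j + int r)" f] by simp
    qed
    then show ?thesis by (auto simp: prod_emb_def B_def PiE_iff)
  qed
  have "emeasure M (T -` B) = emeasure (distr M (count_space UNIV) T) B"
    by (simp add: emeasure_distr[OF T_M] sp)
  also have "\<dots> = emeasure N (T -` B)"
    unfolding same by (simp add: emeasure_distr[OF T_N] sp)
  finally show "emeasure M (prod_emb UNIV (\<lambda>_. count_space UNIV) J (Pi\<^sub>E J A)) =
      emeasure N (prod_emb UNIV (\<lambda>_. count_space UNIV) J (Pi\<^sub>E J A))"
    by (simp only: emb)
qed

lemma stationary_chain_one_time_law: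
  assumes "stationary_markov_chain \<Omega> M P"
  shows "\<exists>\<pi>. (\<forall>n x. measure \<Omega> {\<omega>\<in>space \<Omega>. M n \<omega> = x} = pmf \<pi> x) \<and> bind_pmf \<pi> (kernel_pmf P) = \<pi>"
proof -
  from assms have ps: "prob_space \<Omega>" and st: "stochastic_matrix P"
    and meas: "\<And>n. M n \<in> measurable \<Omega> (count_space UNIV)"
    and stat: "\<And>n x. measure \<Omega> {\<omega>\<in>space \<Omega>. M n \<omega> = x} = measure \<Omega> {\<omega>\<in>space \<Omega>. M 0 \<omega> = x}"
    and fdd: "\<And>n xs. xs \<noteq> [] \<Longrightarrow> measure \<Omega> {\<omega>\<in>space \<Omega>. \<forall>i<length xs. M (n + int i) \<omega> = xs ! i} =
      measure \<Omega> {\<omega>\<in>space \<Omega>. M n \<omega> = hd xs} * (\<Prod>i<length xs - 1. P (xs ! i) (xs ! Suc i))"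
    unfolding stationary_markov_chain_def by auto
  interpret prob_space \<Omega> by fact
  interpret markov_kernel P by unfold_locales fact
  define \<pi> where "\<pi> = embed_pmf (\<lambda>x. prob {\<omega>\<in>space \<Omega>. M 0 \<omega> = x})"
  have "((\<lambda>x. prob {\<omega>\<in>space \<Omega>. M 0 \<omega> = x}) has_sum 1) UNIV"
    using has_sum_measure_partition[OF sets.top meas[of 0]] by (simp add: prob_space)
  then have pi: "pmf \<pi> x = prob {\<omega>\<in>space \<Omega>. M 0 \<omega> = x}" for x
    unfolding \<pi>_def by (rule embed_pmf_has_sum) simp
  have "bind_pmf \<pi> K = \<pi>"
  proof (rule pmf_eqI)
    fix x
    have E: "{\<omega>\<in>space \<Omega>. M 1 \<omega> = x} \<in> sets \<Omega>"
      using measurable_sets[OF meas[of 1], of "{x}"] by (simp add: vimage_def Int_def conj_commute)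
    have "((\<lambda>y. prob {\<omega>\<in>{\<omega>\<in>space \<Omega>. M 1 \<omega> = x}. M 0 \<omega> = y}) has_sum pmf \<pi> x) UNIV"
      using has_sum_measure_partition[OF E meas[of 0]] stat[of 1 x] by (simp add: pi)
    moreover have "prob {\<omega>\<in>{\<omega>\<in>space \<Omega>. M 1 \<omega> = x}. M 0 \<omega> = y} = pmf \<pi> y * pmf (K y) x" for y
    proof -
      have "{\<omega>\<in>{\<omega>\<in>space \<Omega>. M 1 \<omega> = x}. M 0 \<omega> = y} = {\<omega>\<in>space \<Omega>. \<forall>i<length [y, x]. M (0 + int i) \<omega> = [y, x] ! i}"
        by (auto simp: less_Suc_eq)
      then show ?thesis using fdd[of "[y, x]" 0] by (simp add: pi)
    qed
    ultimately have "((\<lambda>y. pmf \<pi> y * pmf (K y) x) has_sum pmf \<pi> x) UNIV" by simp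
    with pmf_bind_has_sum show "pmf (bind_pmf \<pi> K) x = pmf \<pi> x"
      by (rule has_sum_unique)
  qed
  moreover have "prob {\<omega>\<in>space \<Omega>. M n \<omega> = x} = pmf \<pi> x" for n x
    unfolding pi by (rule stat)
  ultimately show ?thesis by blast
qed

theorem theorem1:
  fixes \<Omega> :: "'w measure" and M :: "int \<Rightarrow> 'w \<Rightarrow> 'a::countable" and P :: "'a \<Rightarrow> 'a \<Rightarrow> real"
  assumes "stationary_markov_chain \<Omega> M P"
    and "ergodic_chain P"
    and "exponential_return_times P"
  shows "finitary_factor_of_iid_exp_tails \<Omega> M"
proof -
  from assms(1) have st: "stochastic_matrix P" and ps: "prob_space \<Omega>"
    and meas: "\<And>n. M n \<in> measurable \<Omega> (count_space UNIV)"
    and fdd: "\<And>n xs. xs \<noteq> [] \<Longrightarrow> measure \<Omega> {\<omega>\<in>space \<Omega>. \<forall>i<length xs. M (n + int i) \<omega> = xs ! i} =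
      measure \<Omega> {\<omega>\<in>space \<Omega>. M n \<omega> = hd xs} * (\<Prod>i<length xs - 1. P (xs ! i) (xs ! Suc i))"
    unfolding stationary_markov_chain_def by auto
  from assms(2) have irr: "irreducible_chain P" and ap: "aperiodic_chain P"
    unfolding ergodic_chain_def by auto
  obtain s C c where s: "c > 0" "\<And>n. return_tail P s n \<le> C * exp (- c * real n)"
    using assms(3) unfolding exponential_return_times_def by blast
  interpret K: markov_kernel P by unfold_locales (rule st)
  interpret \<Omega>: prob_space \<Omega> by (rule ps)
  obtain m p where p: "0 < p" "p < 1" and h_nonneg: "\<And>k x. K.age_mass s m p k x \<ge> 0"
    using K.exists_nonneg_age_mass[OF ap s] by blast
  let ?h = "K.age_mass s m p"
  \<comment> \<open>At age 0 the mass is concentrated at \<open>s\<close>, so the normaliser of the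
    backward kernel is \<open>P s y\<close>.\<close>
  have back0: "?h (Suc 0) y + gap_prob m p 0 * ?h 0 y = P s y" for y
  proof (rule has_sum_unique[OF K.age_mass_step])
    show "((\<lambda>x. ?h 0 x * P x y) has_sum P s y) UNIV"
      by (rule has_sum_finite_neutralI[of "{s}"]) (auto simp: K.age_mass_0)
  qed
  \<comment> \<open>The clause for \<open>k = 0\<close> is explicit because the equations leave
    \<open>q\<close> free where the normaliser \<open>P s y\<close> is 0, while
    \<open>samp_0\<close> demands the state \<open>s\<close> there too.\<close>
  define good where "good k z q \<longleftrightarrow> (k = 0 \<longrightarrow> q = return_pmf s) \<and>
      (z = None \<longrightarrow> (\<forall>x. pmf q x * gap_tail m p k = ?h k x)) \<and>
      (\<forall>y. z = Some y \<longrightarrow> (\<forall>x. pmf q x * (?h (Suc k) y + gap_prob m p k * ?h 0 y) = ?h k x * P x y))"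
    for k z q
  have "\<exists>q. good k z q" for k z
  proof (cases "k = 0")
    case True
    have "pmf (return_pmf s) x * (?h (Suc 0) y + gap_prob m p 0 * ?h 0 y) = ?h 0 x * P x y" for x y
      unfolding back0 by (simp add: K.age_mass_0 pmf_return)
    then have "good 0 z (return_pmf s)"
      unfolding good_def by (simp add: K.age_mass_0 pmf_return del: One_nat_def)
    then show ?thesis using True by blast
  next
    case False
    show ?thesis
    proof (cases z)
      case None
      then show ?thesis
        using False ex_pmf_normalized[OF K.age_mass_total h_nonneg] by (simp add: good_def)
    next
      case (Some y)
      have "\<exists>q. \<forall>x. pmf q x * (?h (Suc k) y + gap_prob m p k * ?h 0 y) = ?h k x * P x y"
        by (rule ex_pmf_normalized[OF K.age_mass_step]) (simp add: h_nonneg K.P_nonneg)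
      then show ?thesis using False Some by (simp add: good_def)
    qed
  qed
  then obtain \<kappa> where good: "\<And>k z. good k z (\<kappa> k z)" by metis
  have \<kappa>: "\<kappa> 0 z = return_pmf s" "pmf (\<kappa> k None) x * gap_tail m p k = ?h k x"
    "pmf (\<kappa> k (Some y)) x * (?h (Suc k) y + gap_prob m p k * ?h 0 y) = ?h k x * P x y" for k x y z
    using good[of 0 z] good[of k None] good[of k "Some y"] by (simp_all add: good_def)
  obtain \<nu> :: "real measure" and bit samp where \<nu>: "prob_space \<nu>" "sets \<nu> = sets borel" "Measurable.pred borel bit"
    "\<And>i. samp i \<in> measurable borel (count_space UNIV)" "\<And>i t. samp i t \<in> set_pmf (case_prod \<kappa> i)"
    "\<And>i b y. measure \<nu> {t. bit t = b \<and> samp i t = y} = (if b then p else 1 - p) * pmf (case_prod \<kappa> i) y"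
    using exists_marked_sampler[OF p, of "case_prod \<kappa>"] by blast
  \<comment> \<open>Pointwise, since the sampler never leaves the support of a point mass.\<close>
  have samp0: "samp (0, z) t = s" for z t using \<nu>(5)[of "(0, z)" t] \<kappa>(1) by simp
  interpret \<nu>: prob_space \<nu> by (rule \<nu>(1))
  interpret B: backward_sampler \<nu> bit p m P s \<kappa> "\<lambda>k z. samp (k, z)"
  proof unfold_locales
    show "measure \<nu> {t. bit t} = p"
      using \<nu>(6)[of True "(0, None)" s] by (simp add: samp0 \<kappa>(1))
    show "pmf (\<kappa> k None) x * gap_tail m p k = ?h k x" for k x by (rule \<kappa>(2))
    show "pmf (\<kappa> k (Some y)) x * (?h (Suc k) y + gap_prob m p k * ?h 0 y) = ?h k x * P x y" for k x y
      by (rule \<kappa>(3))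
    show "measure \<nu> {t. bit t = b \<and> samp (k, z) t = y} = (if b then p else 1 - p) * pmf (\<kappa> k z) y" for k z b y
      using \<nu>(6)[of b "(k, z)" y] by simp
  qed (use \<nu> p samp0 in auto)
  obtain \<pi> where \<pi>: "\<And>n x. measure \<Omega> {\<omega>\<in>space \<Omega>. M n \<omega> = x} = pmf \<pi> x" "bind_pmf \<pi> (kernel_pmf P) = \<pi>"
    using stationary_chain_one_time_law[OF assms(1)] by blast
  have init: "B.init_pmf = \<pi>"
    by (rule K.stationary_unique[OF irr B.init_stationary \<pi>(2)])
  let ?S = "PiM UNIV (\<lambda>_::int. count_space (UNIV :: 'a set))"
  have XM: "(\<lambda>y n. B.code (shift_seq n y)) \<in> measurable B.Q ?S"
    unfolding B.code_shift
    by (rule measurable_PiM_single') (use B.X_measurable in \<open>auto cong: measurable_cong_sets\<close>)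
  have MM: "(\<lambda>\<omega> n. M n \<omega>) \<in> measurable \<Omega> ?S"
    by (rule measurable_PiM_single') (use meas in auto)
  have cyl: "{f. \<forall>i<length xs. f (n + int i) = xs ! i} \<in> sets ?S" for n and xs :: "'a list"
  proof -
    have "{f \<in> space ?S. \<forall>i<length xs. f (n + int i) = xs ! i} \<in> sets ?S" by measurable
    then show ?thesis by (simp add: space_PiM)
  qed
  have "distr B.Q ?S (\<lambda>y n. B.code (shift_seq n y)) = distr \<Omega> ?S (\<lambda>\<omega> n. M n \<omega>)"
  proof (rule process_law_eqI)
    fix n and xs :: "'a list" assume xs: "xs \<noteq> []"
    let ?E = "{f. \<forall>i<length xs. f (n + int i) = xs ! i}"
    have "measure (distr B.Q ?S (\<lambda>y n. B.code (shift_seq n y))) ?E =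
        measure B.Q {\<omega>. \<forall>i<length xs. B.X \<omega> (n + int i) = xs ! i}"
      by (subst measure_distr[OF XM cyl]) (simp add: B.code_shift vimage_def)
    also have "\<dots> = pmf \<pi> (hd xs) * (\<Prod>i<length xs - 1. P (xs ! i) (xs ! Suc i))"
      using B.pr_X[OF xs] B.path_weight_prod[OF xs] by (simp add: init)
    also have "\<dots> = measure \<Omega> {\<omega>\<in>space \<Omega>. \<forall>i<length xs. M (n + int i) \<omega> = xs ! i}"
      using fdd[OF xs] \<pi>(1) by simp
    also have "\<dots> = measure (distr \<Omega> ?S (\<lambda>\<omega> n. M n \<omega>)) ?E"
      by (subst measure_distr[OF MM cyl]) (auto intro!: arg_cong[where f="measure \<Omega>"])
    finally show "measure (distr B.Q ?S (\<lambda>y n. B.code (shift_seq n y))) ?E = measure (distr \<Omega> ?S (\<lambda>\<omega> n. M n \<omega>)) ?E" .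
  qed (use B.Q.prob_space_distr[OF XM] \<Omega>.prob_space_distr[OF MM] in auto)
  then show ?thesis
    unfolding finitary_factor_of_iid_exp_tails_def
    using \<nu>(1,2) B.coding B.window_tails by blast
qed

end
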